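(* Let $N\in\mathbb N$, let $\Phi$ be a real $N\times N$ matrix with spectrum $\sigma$, and let $\varepsilon=(\varepsilon_t)_{t\in\mathbb Z}$ be a subexponential sequence of real $N\times1$ vectors. Call a sequence $x=(x_t)_{t\in\mathbb Z}$ in $\mathbb R^N$ a solution if $x_t=\Phi x_{t-1}+\varepsilon_t$ for each $t\in\mathbb Z$. Let $f_{\Phi,\varepsilon}$ be the map from $\mathbb V_{\rightarrow}\times\mathbb V_{\leftarrow}\times\mathbb V_{\leftrightarrow}$ into the set of all sequences in $\mathbb R^N$ indexed by $\mathbb Z$ defined, for each $t\in\mathbb Z$, by $$f_{\Phi,\varepsilon}(v_{\rightarrow},v_{\leftarrow},v_{\leftrightarrow})_t=\Phi^tv_{\rightarrow}+\sum_{k=0}^\infty\Phi^kP_{<1}\varepsilon_{t-k}+\Phi^tv_{\leftarrow}-\sum_{k=1}^\infty\Phi^{-k}P_{\leftarrow}\varepsilon_{t+k}+\sum_{\theta\in\Theta}\sum_{k=1}^{d_\theta}(\Phi-e^{-i\theta}I)^{k-1}P_\theta\big((C_\theta B)^{k-1}(R_\theta v_{\leftrightarrow}+C_\theta\varepsilon)\big)_t$$ (all series converge). Then $f_{\Phi,\varepsilon}$ is injective and its range is equal to the set of all solutions; that is, $f_{\Phi,\varepsilon}$ defines a one-to-one correspondence between $\mathbb V_{\rightarrow}\times\mathbb V_{\leftarrow}\times\mathbb V_{\leftrightarrow}$ and the set of all solutions. The vector space $\mathbb V_{\rightarrow}\times\mathbb V_{\leftarrow}\times\mathbb V_{\leftrightarrow}$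 has dimension $N-\dim(\mathbb V_\bullet)$. Consequently there is exactly one solution if and only if $\Phi$ is nilpotent, in which case the unique solution is given by $x_t=\sum_{k=0}^{N-1}\Phi^k\varepsilon_{t-k}$ for each $t\in\mathbb Z$; otherwise there are infinitely many solutions.
   Context: Sequences are two-sided, indexed by $t\in\mathbb Z$. A sequence $y=(y_t)_{t\in\mathbb Z}$ in $\mathbb R^N$ is called subexponential if $\sum_{t\in\mathbb Z}r^{|t|}\|y_t\|<\infty$ for each $r\in(0,1)$, where $\|\cdot\|$ is the Euclidean norm. Spectral projections. $\sigma\subset\mathbb C$ is the set of complex eigenvalues of $\Phi$. The generalized eigenspace of $\lambda\in\sigma$ is $\{v\in\mathbb C^N:(\Phi-\lambda I)^Nv=0\}$. For $A\subseteq\sigma$, the spectral projection $P_A$ is the $N\times N$ matrix of the projection on the direct sum of the generalized eigenspaces of the eigenvalues in $A$ along the direct sum of the generalized eigenspaces of the eigenvalues in $\sigma\setminus A$ ($P_\emptyset=0$, $P_\sigma=I$). Define - $P_\bullet=P_A$ with $A=\{\lambda\in\sigma:\lambda=0\}$; - $P_{<1}=P_A$ with $A=\{\lambda\in\sigma:|\lambda|<1\}$; - $P_{\rightarrow}=P_A$ with $A=\{\lambda\in\sigma:0<|\lambda|<1\}$; - $P_{\leftarrow}=P_A$ with $A=\{\lambda\in\sigma:|\lambda|>1\}$; - $P_{\leftrightarrow}=P_A$ with $A=\{\lambda\in\sigma:|\lambda|=1\}$. These are real matrices, since the sets $A$ are closed under complex conjugation. $\mathbb V_\bullet,\mathbb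 V_{\rightarrow},\mathbb V_{\leftarrow},\mathbb V_{\leftrightarrow}\subseteq\mathbb R^N$ denote the real column spaces of $P_\bullet,P_{\rightarrow},P_{\leftarrow},P_{\leftrightarrow}$ respectively. Let $\Theta=\{\theta\in(-\pi,\pi]:e^{-i\theta}\in\sigma\}$. For $\theta\in\Theta$, $P_\theta=P_{\{e^{-i\theta}\}}$ (a possibly complex matrix), and $d_\theta$ is the index of the eigenvalue $e^{-i\theta}$, i.e. the size of the largest Jordan block associated with $e^{-i\theta}$ in the Jordan normal form of $\Phi$. The sum over $\theta\in\Theta$ in the definition of $f_{\Phi,\varepsilon}$ is real because the summands for $\theta$ and $-\theta$ are complex conjugates. Negative powers. $\Phi$ is not assumed invertible. For $k\in\mathbb N$, $\Phi^{-k}$ denotes $(\Phi^{\mathrm D})^k$, where $\Phi^{\mathrm D}$ is the Drazin inverse of $\Phi$: the unique $N\times N$ matrix satisfying $\Phi^{\mathrm D}\Phi\Phi^{\mathrm D}=\Phi^{\mathrm D}$, $\Phi^{\mathrm D}\Phi=\Phi\Phi^{\mathrm D}$ and $\Phi^{\mathrm D}\Phi^{N+1}=\Phi^N$. Also $\Phi^0=I$. Operators. Let $\mathbb S$ be the complex linear space of all sequences $(y_t)_{t\in\mathbb Z}$ in $\mathbb C^N$. The backshift operator $B:\mathbb S\to\mathbb S$ is $(By)_t=y_{t-1}$. For $\theta\in(-\pi,\pi]$ the cumulation operator $C_\theta:\mathbb S\to\mathbb S$ is given by $(C_\theta y)_t=-\sum_{s=0}^{-t-1}e^{-i\theta(t+s)}y_{-s}$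 for $t<0$, $(C_\theta y)_0=0$, and $(C_\theta y)_t=\sum_{s=1}^te^{-i\theta(t-s)}y_s$ for $t>0$. The residual operator $R_\theta:\mathbb C^N\to\mathbb S$ is $(R_\theta v)_t=e^{-i\theta t}v$. Zeroth powers of operators and matrices are identities. *)

theory Defs
  imports
    "Jordan_Normal_Form.Jordan_Normal_Form"
    "HOL-Analysis.Analysis"
begin

no_notation Matrix.vec_index (infixl "$" 100)
no_notation Matrix.scalar_prod (infix "\<bullet>" 70)
hide_const (open) Matrix.mat Matrix.vec
hide_type (open) Matrix.vec Matrix.mat

section \<open>Matrices\<close>

text \<open>The library's power operator on the type \<open>'a^'n^'n\<close> would be entrywise, hence a separate
  function for the powers of a square matrix.\<close>

primrec matpow :: "'a::semiring_1^'n^'n \<Rightarrow> nat \<Rightarrow> 'a^'n^'n" where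
  "matpow A 0 = mat 1"
| "matpow A (Suc k) = A ** matpow A k"

definition nilpotent_matrix :: "'a::semiring_1^'n^'n \<Rightarrow> bool" where
  "nilpotent_matrix A \<longleftrightarrow> (\<exists>k. matpow A k = 0)"

definition drazin_inverse :: "real^'n^'n \<Rightarrow> real^'n^'n" where
  "drazin_inverse A = (THE D. D ** A ** D = D \<and> D ** A = A ** D
     \<and> D ** matpow A (CARD('n) + 1) = matpow A CARD('n))"

definition matpow_int :: "real^'n^'n \<Rightarrow> int \<Rightarrow> real^'n^'n" where
  "matpow_int A t =
     (if t \<ge> 0 then matpow A (nat t) else matpow (drazin_inverse A) (nat (- t)))"

definition cvec :: "real^'n \<Rightarrow> complex^'n" where
  "cvec v = (\<chi> i. complex_of_real (v $ i))"

definition cmat :: "real^'n^'n \<Rightarrow> complex^'n^'n" where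
  "cmat A = map_matrix complex_of_real A"

text \<open>The real vector or matrix that a complex one with real entries comes from.\<close>

definition real_vec :: "complex^'n \<Rightarrow> real^'n" where
  "real_vec w = (THE v. cvec v = w)"

definition real_mat :: "complex^'n^'n \<Rightarrow> real^'n^'n" where
  "real_mat M = (THE A. cmat A = M)"

section \<open>Spectrum and spectral projections\<close>

definition spectrum :: "real^'n^'n \<Rightarrow> complex set" where
  "spectrum \<Phi> = {l. \<exists>v. v \<noteq> 0 \<and> cmat \<Phi> *v v = l *s v}"

definition gen_eigenspace :: "real^'n^'n \<Rightarrow> complex \<Rightarrow> (complex^'n) set" where
  "gen_eigenspace \<Phi> l = {v. matpow (cmat \<Phi> - mat l) CARD('n) *v v = 0}"

definition gen_eigenspace_sum :: "real^'n^'n \<Rightarrow> complex set \<Rightarrow> (complex^'n) set" where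
  "gen_eigenspace_sum \<Phi> A = vec.span (\<Union>l\<in>A. gen_eigenspace \<Phi> l)"

definition spectral_proj :: "real^'n^'n \<Rightarrow> complex set \<Rightarrow> complex^'n^'n" where
  "spectral_proj \<Phi> A = (THE P.
     (\<forall>v \<in> gen_eigenspace_sum \<Phi> A. P *v v = v) \<and>
     (\<forall>v \<in> gen_eigenspace_sum \<Phi> (spectrum \<Phi> - A). P *v v = 0))"

definition P_zero :: "real^'n^'n \<Rightarrow> real^'n^'n" where
  "P_zero \<Phi> = real_mat (spectral_proj \<Phi> {l \<in> spectrum \<Phi>. l = 0})"

definition P_less1 :: "real^'n^'n \<Rightarrow> real^'n^'n" where
  "P_less1 \<Phi> = real_mat (spectral_proj \<Phi> {l \<in> spectrum \<Phi>. cmod l < 1})"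

definition P_right :: "real^'n^'n \<Rightarrow> real^'n^'n" where
  "P_right \<Phi> = real_mat (spectral_proj \<Phi> {l \<in> spectrum \<Phi>. 0 < cmod l \<and> cmod l < 1})"

definition P_left :: "real^'n^'n \<Rightarrow> real^'n^'n" where
  "P_left \<Phi> = real_mat (spectral_proj \<Phi> {l \<in> spectrum \<Phi>. cmod l > 1})"

definition P_unit :: "real^'n^'n \<Rightarrow> real^'n^'n" where
  "P_unit \<Phi> = real_mat (spectral_proj \<Phi> {l \<in> spectrum \<Phi>. cmod l = 1})"

definition V_zero :: "real^'n^'n \<Rightarrow> (real^'n) set" where
  "V_zero \<Phi> = span (columns (P_zero \<Phi>))"

definition V_right :: "real^'n^'n \<Rightarrow> (real^'n) set" where
  "V_right \<Phi> = span (columns (P_right \<Phi>))"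

definition V_left :: "real^'n^'n \<Rightarrow> (real^'n) set" where
  "V_left \<Phi> = span (columns (P_left \<Phi>))"

definition V_unit :: "real^'n^'n \<Rightarrow> (real^'n) set" where
  "V_unit \<Phi> = span (columns (P_unit \<Phi>))"

definition Theta :: "real^'n^'n \<Rightarrow> real set" where
  "Theta \<Phi> = {\<theta>. - pi < \<theta> \<and> \<theta> \<le> pi \<and> cis (- \<theta>) \<in> spectrum \<Phi>}"

text \<open>A copy of a matrix in the type on which Jordan normal forms are available. The enumeration
  of the index type used here is arbitrary: another one gives a (permutation) similar matrix,
  which has the same Jordan normal forms.\<close>

definition jnf_mat :: "'a^'n^'n \<Rightarrow> 'a Matrix.mat" where
  "jnf_mat A = Matrix.mat CARD('n) CARD('n)
     (\<lambda>(i, j). A $ from_nat_into UNIV i $ from_nat_into UNIV j)"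

text \<open>\<^const>\<open>jordan_nf\<close> represents a Jordan matrix by its list of (block size, eigenvalue) pairs.
  Any two such lists for the same matrix are permutations of each other.\<close>

definition eigen_index :: "real^'n^'n \<Rightarrow> complex \<Rightarrow> nat" where
  "eigen_index \<Phi> l =
     Max {n. \<exists>n_as. jordan_nf (jnf_mat (cmat \<Phi>)) n_as \<and> (n, l) \<in> set n_as}"

section \<open>Two-sided sequences\<close>

definition subexponential :: "(int \<Rightarrow> real^'n) \<Rightarrow> bool" where
  "subexponential y \<longleftrightarrow>
     (\<forall>r. 0 < r \<and> r < 1 \<longrightarrow> (\<lambda>t. r ^ nat \<bar>t\<bar> * norm (y t)) summable_on UNIV)"

definition backshift :: "(int \<Rightarrow> complex^'n) \<Rightarrow> int \<Rightarrow> complex^'n" where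
  "backshift y t = y (t - 1)"

definition cumulation :: "real \<Rightarrow> (int \<Rightarrow> complex^'n) \<Rightarrow> int \<Rightarrow> complex^'n" where
  "cumulation \<theta> y t =
     (if t < 0 then - (\<Sum>s = 0..- t - 1. cis (- \<theta> * of_int (t + s)) *s y (- s))
      else if t = 0 then 0
      else (\<Sum>s = 1..t. cis (- \<theta> * of_int (t - s)) *s y s))"

definition residual :: "real \<Rightarrow> complex^'n \<Rightarrow> int \<Rightarrow> complex^'n" where
  "residual \<theta> v t = cis (- \<theta> * of_int t) *s v"

section \<open>Solutions\<close>

definition solutions :: "real^'n^'n \<Rightarrow> (int \<Rightarrow> real^'n) \<Rightarrow> (int \<Rightarrow> real^'n) set" where
  "solutions \<Phi> \<epsilon> = {x. \<forall>t. x t = \<Phi> *v x (t - 1) + \<epsilon> t}"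

definition forward_term :: "real^'n^'n \<Rightarrow> (int \<Rightarrow> real^'n) \<Rightarrow> int \<Rightarrow> nat \<Rightarrow> real^'n" where
  "forward_term \<Phi> \<epsilon> t k = (matpow \<Phi> k ** P_less1 \<Phi>) *v \<epsilon> (t - int k)"

definition backward_term :: "real^'n^'n \<Rightarrow> (int \<Rightarrow> real^'n) \<Rightarrow> int \<Rightarrow> nat \<Rightarrow> real^'n" where
  "backward_term \<Phi> \<epsilon> t k = (matpow_int \<Phi> (- int k) ** P_left \<Phi>) *v \<epsilon> (t + int k)"

definition unit_part ::
    "real^'n^'n \<Rightarrow> (int \<Rightarrow> real^'n) \<Rightarrow> real^'n \<Rightarrow> int \<Rightarrow> complex^'n" where
  "unit_part \<Phi> \<epsilon> v t =
     (\<Sum>\<theta> \<in> Theta \<Phi>. \<Sum>k = 1..eigen_index \<Phi> (cis (- \<theta>)).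
        (matpow (cmat \<Phi> - mat (cis (- \<theta>))) (k - 1) ** spectral_proj \<Phi> {cis (- \<theta>)}) *v
        ((cumulation \<theta> \<circ> backshift) ^^ (k - 1))
          (\<lambda>s. residual \<theta> (cvec v) s + cumulation \<theta> (\<lambda>u. cvec (\<epsilon> u)) s) t)"

text \<open>The second series starts at 1, hence the index shift.\<close>

definition sol_map ::
    "real^'n^'n \<Rightarrow> (int \<Rightarrow> real^'n) \<Rightarrow> (real^'n) \<times> (real^'n) \<times> (real^'n) \<Rightarrow> int \<Rightarrow> real^'n" where
  "sol_map \<Phi> \<epsilon> = (\<lambda>(v_right, v_left, v_unit) t.
       matpow_int \<Phi> t *v v_right + (\<Sum>k. forward_term \<Phi> \<epsilon> t k)
     + matpow_int \<Phi> t *v v_left - (\<Sum>k. backward_term \<Phi> \<epsilon> t (Suc k))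
     + real_vec (unit_part \<Phi> \<epsilon> v_unit t))"

end

(* The generalized eigenvectors of \<Phi> found in a Jordan basis span the whole space, so a linear
   identity need only be checked on generalized eigenspaces. By Bezout, the spectral projections are
   polynomials in \<Phi>, and they split the recurrence. On the part with |l| < 1 the powers of \<Phi>, and on
   the part with |l| > 1 the powers of the Drazin inverse, decay geometrically, which beats the
   subexponential \<epsilon>, so the two series are solutions there. On the unit circle, the chain
   (\<Phi> - l)^j (C B)^j telescopes and stops at the index of l. At time 0 the solution map is the sum of
   its three arguments plus a constant, and a homogeneous solution whose value at 0 lies in the
   nilpotent part vanishes, whence the bijection. *)

theory Submission
  imports Defs "Jordan_Normal_Form.Jordan_Normal_Form_Existence" "HOL-Computational_Algebra.Field_as_Ring"
begin

text \<open>The imports above make the names hidden in \<open>Defs\<close> visible again.\<close>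

no_notation Matrix.vec_index (infixl "$" 100)
no_notation Matrix.scalar_prod (infix "\<bullet>" 70)
hide_const (open) Matrix.mat Matrix.vec VectorSpace.subspace
hide_type (open) Matrix.vec Matrix.mat

section \<open>Matrices acting on vectors\<close>

text \<open>\<open>spectral_proj\<close>, \<open>drazin_inverse\<close>, \<open>real_vec\<close> and
  \<open>real_mat\<close> are \<open>THE\<close> terms and say nothing until existence and
  uniqueness are settled. For the projections both rest on the spanning of the generalized
  eigenspaces, which has to be carried over by \<open>jnf_mat\<close> from a second matrix type, the
  one on which Jordan forms live. For the Drazin inverse the witness is
  \<open>(I - P) (\<Phi> + P)^-1\<close>, where \<open>P\<close> belongs to the eigenvalue 0: adding
  \<open>P\<close> makes the nilpotent part invertible and leaves the rest alone. Decay is proved by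
  recursion along chains of generalized eigenvectors. A rate strictly between the modulus of the
  eigenvalue (or of its inverse) and 1 absorbs the polynomial factors of a Jordan block, and such a
  rate is good enough because subexponentiality speaks of every r in (0,1). The obstacle throughout
  is that the recurrence must be followed in both time directions although \<Phi> may be singular.
  Outside the nilpotent part the Drazin inverse is a true inverse; inside it a two-sided solution
  has no freedom at all.\<close>

lemma matpow_commute:
  assumes "A ** B = B ** A"
  shows "matpow A k ** B = B ** matpow A k"
proof (induction k)
  case (Suc k)
  then show ?case
    by (metis assms matpow.simps(2) matrix_mul_assoc)
qed simp

lemma matpow_Suc2: "matpow A (Suc k) = matpow A k ** A"
  by (simp add: matpow_commute)

lemma matpow_add: "matpow A (k + l) = matpow A k ** matpow A l"
  by (induction k) (simp_all add: matrix_mul_assoc)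

lemma mat_vector_mult [simp]: "mat c *v v = c *s (v :: 'a::comm_semiring_1^'n)"
proof -
  have "(\<Sum>j\<in>UNIV. (if i = j then c else 0) * v $ j) = c * v $ i" for i
    by (simp add: if_distrib [of "\<lambda>x. x * _"] cong: if_cong)
  then show ?thesis
    by (simp add: matrix_vector_mult_def mat_def vec_eq_iff)
qed

lemma matrix_vector_mult_sum_right: "A *v (\<Sum>i\<in>I. f i) = (\<Sum>i\<in>I. A *v f i)"
  for A :: "'a::field^'n^'m"
  by (induction I rule: infinite_finite_induct) (simp_all add: matrix_vector_right_distrib)

lemma matrix_vector_mult_sum_left: "(\<Sum>i\<in>I. A i) *v v = (\<Sum>i\<in>I. A i *v v)"
  for v :: "'a::field^'n"
  by (induction I rule: infinite_finite_induct) (simp_all add: matrix_vector_mult_add_rdistrib)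

lemma matrix_vector_mult_axis: "A *v axis a 1 = column a A"
  for A :: "'a::field^'n^'m"
proof -
  have "(\<Sum>j\<in>UNIV. A $ i $ j * (if j = a then 1 else 0)) = A $ i $ a" for i
    by (simp add: if_distrib [of "\<lambda>x. _ * x"] cong: if_cong)
  then show ?thesis
    by (simp add: matrix_vector_mult_def column_def axis_def vec_eq_iff)
qed

lemma matrix_vector_mult_axis_eq: "A *v v = (\<Sum>i\<in>UNIV. v $ i *s (A *v axis i 1))"
  for A :: "'a::field^'n^'m"
  by (subst matrix_mult_sum) (simp add: matrix_vector_mult_axis)

section \<open>Polynomials acting on vectors\<close>

text \<open>Polynomials act on vectors because \<open>*\<close> and \<open>^\<close> on this matrix
  type are entrywise, so that \<open>poly\<close> cannot evaluate at a matrix.\<close>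

definition poly_act :: "'a::field^'n^'n \<Rightarrow> 'a poly \<Rightarrow> 'a^'n \<Rightarrow> 'a^'n" where
  "poly_act A p v = (\<Sum>i\<le>degree p. coeff p i *s (matpow A i *v v))"

lemma poly_act_bound:
  assumes "degree p \<le> n"
  shows "poly_act A p v = (\<Sum>i\<le>n. coeff p i *s (matpow A i *v v))"
  unfolding poly_act_def
  by (rule sum.mono_neutral_left) (use assms in \<open>auto simp: coeff_eq_0\<close>)

lemma poly_act_0 [simp]: "poly_act A 0 v = 0"
  by (simp add: poly_act_def)

lemma poly_act_pCons [simp]: "poly_act A (pCons a p) v = a *s v + A *v poly_act A p v"
proof -
  have "poly_act A (pCons a p) v
      = (\<Sum>i\<le>Suc (degree p). coeff (pCons a p) i *s (matpow A i *v v))"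
    by (rule poly_act_bound) (rule degree_pCons_le)
  also have "\<dots> = a *s v + A *v poly_act A p v"
    by (simp del: sum.atMost_Suc add: sum.atMost_Suc_shift poly_act_def matrix_vector_mult_sum_right
        matrix_vector_mul_assoc [symmetric] vector_scalar_commute)
  finally show ?thesis .
qed

lemma poly_act_zero_right [simp]: "poly_act A p 0 = 0"
  by (induction p) simp_all

lemma poly_act_add: "poly_act A (p + q) v = poly_act A p v + poly_act A q v"
proof (induction p q rule: poly_induct2)
  case (pCons a p b q)
  then show ?case by (simp add: matrix_vector_right_distrib vec.scale_left_distrib algebra_simps)
qed simp

lemma poly_act_smult: "poly_act A (Polynomial.smult c p) v = c *s poly_act A p v"
  by (induction p) (simp_all add: vec.scale_right_distrib vector_scalar_commute)

lemma poly_act_mult: "poly_act A (p * q) v = poly_act A p (poly_act A q v)"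
  by (induction p) (simp_all add: poly_act_add poly_act_smult)

lemma poly_act_1 [simp]: "poly_act A 1 v = v"
  by (simp add: one_pCons)

lemma poly_act_linear_power:
  "poly_act A ([:- e, 1:] ^ k) v = matpow (A - mat e) k *v v"
proof (induction k arbitrary: v)
  case (Suc k)
  have "poly_act A ([:- e, 1:] ^ Suc k) v = poly_act A [:- e, 1:] (poly_act A ([:- e, 1:] ^ k) v)"
    by (simp only: power_Suc poly_act_mult)
  then show ?case
    by (simp add: Suc.IH matrix_vector_mul_assoc [symmetric] matrix_vector_mult_diff_rdistrib)
qed simp

text \<open>Turns the action into a matrix, so that a polynomial in \<open>A\<close> can be a
  witness for a projection and its kernel is visibly a subspace.\<close>

lemma poly_act_matrix: "\<exists>M. \<forall>v. poly_act A p v = M *v v"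
proof (induction p)
  case 0
  show ?case by (auto intro!: exI [of _ 0])
next
  case (pCons a p)
  then obtain M where "\<forall>v. poly_act A p v = M *v v" by blast
  then have "\<forall>v. poly_act A (pCons a p) v = (mat a + A ** M) *v v"
    by (simp add: matrix_vector_mult_add_rdistrib matrix_vector_mul_assoc)
  then show ?case by blast
qed

text \<open>Monic linear factors with different roots differ by a nonzero constant, so a common
  divisor is a unit; this passes to powers and products. It feeds Bezout in
  \<open>spectral_proj_ex\<close>.\<close>

lemma coprime_linear_factors:
  fixes S T :: "complex set"
  assumes "finite S" "finite T" "S \<inter> T = {}"
  shows "coprime (\<Prod>a\<in>S. [:- a, 1:] ^ m) (\<Prod>b\<in>T. [:- b, 1:] ^ m)"
proof (intro prod_coprime_left prod_coprime_right coprime_power_left_iff [THEN iffD2]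
    coprime_power_right_iff [THEN iffD2] disjI1)
  fix a b assume "a \<in> S" "b \<in> T"
  then have "a \<noteq> b" using assms by auto
  show "coprime [:- a, 1:] [:- b, 1:]"
  proof (rule coprimeI)
    fix c assume "c dvd [:- a, 1:]" "c dvd [:- b, 1:]"
    then have "c dvd [:- a, 1:] - [:- b, 1:]" by (rule dvd_diff)
    then have "c dvd [:b - a:]" by simp
    then show "is_unit c"
      using \<open>a \<noteq> b\<close> by (metis diff_pCons dvd_trans is_unit_pCons_iff right_minus_eq)
  qed
qed

section \<open>Generalized eigenvectors from the Jordan normal form\<close>

text \<open>Peels off the first block, so that facts about Jordan matrices can be proved by
  induction on the list of blocks.\<close>

lemma diag_block_mat_Cons_index:
  fixes f :: "nat \<times> 'b \<Rightarrow> 'a::zero Matrix.mat"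
  assumes f: "\<And>x. dim_row (f x) = fst x" "\<And>x. dim_col (f x) = fst x"
    and ij: "i < fst x + sum_list (map fst xs)" "j < fst x + sum_list (map fst xs)"
  shows "diag_block_mat (map f (x # xs)) $$ (i, j) =
    (if i < fst x then if j < fst x then f x $$ (i, j) else 0
     else if j < fst x then 0 else diag_block_mat (map f xs) $$ (i - fst x, j - fst x))"
proof -
  let ?B = "diag_block_mat (map f xs)"
  have dim: "dim_row ?B = sum_list (map fst xs)" "dim_col ?B = sum_list (map fst xs)"
    by (simp_all add: dim_diag_block_mat o_def f)
  show ?thesis
    using ij by (simp add: Let_def f dim)
qed

lemma jordan_matrix_shift_pow:
  fixes e :: "'a::comm_ring_1"
  shows "jordan_matrix (map (\<lambda>(m, a). (m, a - e)) n_as) ^\<^sub>m k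
    = diag_block_mat (map (\<lambda>x. jordan_block (fst x) (snd x - e) ^\<^sub>m k) n_as)"
  by (simp add: jordan_matrix_pow o_def case_prod_unfold)

text \<open>Column \<open>j\<close> runs through a single block. Subtracting the eigenvalue of that
  block makes it nilpotent of order its size, and the other blocks have no entries in this column.
  So the \<open>j\<close>-th unit vector is a generalized eigenvector.\<close>

lemma jordan_matrix_gen_eigenvector:
  fixes n_as :: "(nat \<times> 'a::comm_ring_1) list"
  assumes "j < sum_list (map fst n_as)"
  shows "\<exists>(n, e) \<in> set n_as. \<forall>k\<ge>n. \<forall>i < sum_list (map fst n_as).
    (jordan_matrix (map (\<lambda>(m, a). (m, a - e)) n_as) ^\<^sub>m k) $$ (i, j) = 0"
  using assms unfolding jordan_matrix_shift_pow
proof (induction n_as arbitrary: j)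
  case (Cons x n_as)
  note index = diag_block_mat_Cons_index [where f = "\<lambda>x. jordan_block (fst x) (snd x - e) ^\<^sub>m k" for e k,
      OF jordan_block_pow_dim]
  show ?case
  proof (cases "j < fst x")
    case True
    \<comment> \<open>The shifted block has eigenvalue 0, so its \<open>k\<close>-th power has
      entries only \<open>k\<close> places above the diagonal: none once \<open>k\<close> reaches
      the block size.\<close>
    have "diag_block_mat (map (\<lambda>y. jordan_block (fst y) (snd y - snd x) ^\<^sub>m k) (x # n_as)) $$ (i, j) = 0"
      if "k \<ge> fst x" "i < sum_list (map fst (x # n_as))" for k i
      using True that by (subst index) (auto simp: jordan_block_pow power_0_left)
    then show ?thesis by (intro bexI [of _ x]) (auto simp: case_prod_unfold simp del: list.map diag_block_mat.simps)
  next
    case False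
    with Cons.prems have "j - fst x < sum_list (map fst n_as)" by simp
    from Cons.IH [OF this] obtain y where y: "y \<in> set n_as"
      and *: "\<And>k i. k \<ge> fst y \<Longrightarrow> i < sum_list (map fst n_as) \<Longrightarrow>
        diag_block_mat (map (\<lambda>x. jordan_block (fst x) (snd x - snd y) ^\<^sub>m k) n_as) $$ (i, j - fst x) = 0"
      by (auto simp: case_prod_unfold)
    have "diag_block_mat (map (\<lambda>x. jordan_block (fst x) (snd x - snd y) ^\<^sub>m k) (x # n_as)) $$ (i, j) = 0"
      if "k \<ge> fst y" "i < sum_list (map fst (x # n_as))" for k i
      using False Cons.prems that * by (subst index) auto
    then show ?thesis using y
      by (intro bexI [of _ y]) (auto simp: case_prod_unfold simp del: list.map diag_block_mat.simps)
  qed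
qed simp

lemma jordan_matrix_shift:
  fixes e :: "'a::comm_ring_1"
  assumes "i < sum_list (map fst n_as)" "j < sum_list (map fst n_as)"
  shows "jordan_matrix (map (\<lambda>(m, a). (m, a - e)) n_as) $$ (i, j)
    = jordan_matrix n_as $$ (i, j) - (if i = j then e else 0)"
proof -
  have *: "jordan_matrix (map (\<lambda>(m, a). (m, a - e)) n_as)
      = diag_block_mat (map (\<lambda>x. jordan_block (fst x) (snd x - e)) n_as)"
    "jordan_matrix n_as = diag_block_mat (map (\<lambda>x. jordan_block (fst x) (snd x)) n_as)"
    by (simp_all add: jordan_matrix_def o_def case_prod_unfold)
  show ?thesis
    unfolding * using assms
  proof (induction n_as arbitrary: i j)
    case (Cons x n_as)
    show ?case
      using Cons.prems
      by (subst (1 2) diag_block_mat_Cons_index) (auto simp: Cons.IH)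
  qed simp
qed

section \<open>Transfer between the two matrix types\<close>

lemma bij_betw_index: "bij_betw (from_nat_into (UNIV :: 'n::finite set)) {..<CARD('n)} UNIV"
  by (rule bij_betw_from_nat_into_finite) simp

lemma index_eq_iff:
  assumes "i < CARD('n)" "j < CARD('n)"
  shows "from_nat_into (UNIV :: 'n::finite set) i = from_nat_into UNIV j \<longleftrightarrow> i = j"
  using assms by (intro inj_on_eq_iff [OF bij_betw_imp_inj_on [OF bij_betw_index]]) simp_all

lemma obtain_index:
  obtains i where "i < CARD('n)" "a = from_nat_into (UNIV :: 'n::finite set) i"
proof -
  have "a \<in> from_nat_into UNIV ` {..<CARD('n)}"
    by (simp only: bij_betw_imp_surj_on [OF bij_betw_index] UNIV_I)
  then show thesis using that by blast
qed

lemma jnf_mat_dim [simp]: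
  "dim_row (jnf_mat (A :: 'a^'n^'n)) = CARD('n)" "dim_col (jnf_mat (A :: 'a^'n^'n)) = CARD('n)"
  by (simp_all add: jnf_mat_def)

lemma jnf_mat_carrier [simp]: "jnf_mat (A :: 'a^'n^'n) \<in> carrier_mat CARD('n) CARD('n)"
  by (rule carrier_matI) simp_all

lemma jnf_mat_index:
  fixes A :: "'a^'n^'n"
  assumes "i < CARD('n)" "j < CARD('n)"
  shows "jnf_mat A $$ (i, j) = A $ from_nat_into UNIV i $ from_nat_into UNIV j"
  using assms by (simp add: jnf_mat_def)

lemma jnf_mat_mult: "jnf_mat (A ** B) = jnf_mat A * jnf_mat (B :: 'a::comm_ring_1^'n^'n)"
proof (rule eq_matI)
  fix i j assume "i < dim_row (jnf_mat A * jnf_mat B)" "j < dim_col (jnf_mat A * jnf_mat B)"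
  then have ij: "i < CARD('n)" "j < CARD('n)" by simp_all
  have "(jnf_mat A * jnf_mat B) $$ (i, j) = (\<Sum>k<CARD('n). jnf_mat A $$ (i, k) * jnf_mat B $$ (k, j))"
    using ij by (auto simp: scalar_prod_def atLeast0LessThan intro!: sum.cong)
  also have "\<dots> = (\<Sum>k<CARD('n). A $ from_nat_into UNIV i $ from_nat_into UNIV k
      * B $ from_nat_into UNIV k $ from_nat_into UNIV j)"
    using ij by (intro sum.cong) (simp_all add: jnf_mat_index)
  also have "\<dots> = jnf_mat (A ** B) $$ (i, j)"
    using ij by (simp add: jnf_mat_index matrix_matrix_mult_def
        sum.reindex_bij_betw [OF bij_betw_index, of "\<lambda>k. A $ from_nat_into UNIV i $ k * B $ k $ from_nat_into UNIV j"])
  finally show "jnf_mat (A ** B) $$ (i, j) = (jnf_mat A * jnf_mat B) $$ (i, j)" by simp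
qed simp_all

lemma jnf_mat_one: "jnf_mat (mat 1 :: 'a::comm_ring_1^'n^'n) = 1\<^sub>m CARD('n)"
  by (rule eq_matI) (simp_all add: jnf_mat_index mat_def index_eq_iff)

lemma jnf_mat_matpow: "jnf_mat (matpow A k) = jnf_mat (A :: 'a::comm_ring_1^'n^'n) ^\<^sub>m k"
proof (induction k)
  case (Suc k)
  then show ?case by (simp only: matpow_Suc2 jnf_mat_mult pow_mat.simps)
qed (simp add: jnf_mat_one)

lemma jnf_mat_inject:
  assumes "jnf_mat A = jnf_mat B"
  shows "A = (B :: 'a^'n^'n)"
proof -
  have "A $ a $ b = B $ a $ b" for a b
  proof -
    obtain i where i: "i < CARD('n)" "a = from_nat_into UNIV i" by (rule obtain_index)
    obtain j where j: "j < CARD('n)" "b = from_nat_into UNIV j" by (rule obtain_index)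
    show ?thesis using arg_cong [OF assms, of "\<lambda>M. M $$ (i, j)"] i j by (simp add: jnf_mat_index)
  qed
  then show ?thesis by (simp add: vec_eq_iff)
qed

lemma jnf_mat_surject:
  assumes "M \<in> carrier_mat CARD('n) CARD('n)"
  obtains A :: "'a^'n^'n" where "jnf_mat A = M"
proof
  let ?g = "inv_into {..<CARD('n)} (from_nat_into (UNIV :: 'n set))"
  have g: "?g (from_nat_into UNIV i) = i" if "i < CARD('n)" for i
    using that by (intro inv_into_f_f bij_betw_imp_inj_on [OF bij_betw_index]) simp
  show "jnf_mat ((\<chi> a b. M $$ (?g a, ?g b)) :: 'a^'n^'n) = M"
  proof (rule eq_matI)
    fix i j assume "i < dim_row M" "j < dim_col M"
    then have "i < CARD('n)" "j < CARD('n)" using assms by simp_all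
    then show "jnf_mat ((\<chi> a b. M $$ (?g a, ?g b)) :: 'a^'n^'n) $$ (i, j) = M $$ (i, j)"
      by (simp add: jnf_mat_index g)
  qed (use assms in simp_all)
qed

text \<open>The block sizes add up to the dimension. The bound makes the set under
  \<open>Max\<close> in \<open>eigen_index\<close> finite and links block sizes to the exponent in
  \<open>gen_eigenspace\<close>.\<close>

lemma jordan_nf_block_le:
  assumes "jordan_nf (jnf_mat (A :: complex^'n^'n)) n_as" "(n, e) \<in> set n_as"
  shows "n \<le> CARD('n)"
proof -
  obtain P Q where "similar_mat_wit (jnf_mat A) (jordan_matrix n_as) P Q"
    using assms by (auto simp: jordan_nf_def similar_mat_def)
  then have *: "sum_list (map fst n_as) = CARD('n)"
    unfolding similar_mat_wit_def Let_def by (metis carrier_matD(1) insert_subset jnf_mat_dim(1) jordan_matrix_dim(1))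
  have "n \<in> set (map fst n_as)" using assms(2) by force
  from member_le_sum_list [OF this] show "n \<le> CARD('n)" using * by simp
qed

text \<open>The columns of the transition matrix are the Jordan basis:
  \<open>A ** P' = P' ** J\<close> carries the unit vectors, which are generalized eigenvectors of
  \<open>J\<close>, to generalized eigenvectors of \<open>A\<close>, and
  \<open>v = P' *v (Q' *v v)\<close> combines these columns.\<close>

lemma jordan_nf_span:
  fixes A :: "complex^'n^'n"
  assumes jnf: "jordan_nf (jnf_mat A) n_as"
  shows "v \<in> vec.span (\<Union>(n, e)\<in>set n_as. {w. matpow (A - mat e) n *v w = 0})"
    (is "v \<in> vec.span ?G")
proof -
  obtain P Q where wit: "similar_mat_wit (jnf_mat A) (jordan_matrix n_as) P Q"
    using jnf by (auto simp: jordan_nf_def similar_mat_def)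
  have carrier: "P \<in> carrier_mat CARD('n) CARD('n)" "Q \<in> carrier_mat CARD('n) CARD('n)"
      "jordan_matrix n_as \<in> carrier_mat CARD('n) CARD('n)"
    and PQ: "P * Q = 1\<^sub>m CARD('n)" "Q * P = 1\<^sub>m CARD('n)"
    and A: "jnf_mat A = P * jordan_matrix n_as * Q"
    using wit unfolding similar_mat_wit_def Let_def by simp_all
  have sum: "sum_list (map fst n_as) = CARD('n)"
    using carrier_matD(1) [OF carrier(3)] by simp
  obtain P' :: "complex^'n^'n" where P': "jnf_mat P' = P" using jnf_mat_surject [OF carrier(1)] .
  obtain Q' :: "complex^'n^'n" where Q': "jnf_mat Q' = Q" using jnf_mat_surject [OF carrier(2)] .
  obtain J :: "complex^'n^'n" where J: "jnf_mat J = jordan_matrix n_as"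
    using jnf_mat_surject [OF carrier(3)] .
  have PQ': "P' ** Q' = mat 1" "Q' ** P' = mat 1"
    by (rule jnf_mat_inject, simp add: jnf_mat_mult jnf_mat_one P' Q' PQ)+
  have "A = P' ** J ** Q'"
    by (rule jnf_mat_inject) (simp add: jnf_mat_mult P' Q' J A)
  then have AP: "A ** P' = P' ** J"
    by (metis PQ'(2) matrix_mul_assoc matrix_mul_rid)
  have AP_pow: "matpow (A - mat e) k ** P' = P' ** matpow (J - mat e) k" for e k
  proof (induction k)
    case (Suc k)
    have *: "(A - mat e) ** P' = P' ** (J - mat e)"
      by (rule matrix_eq [THEN iffD2])
        (simp add: AP matrix_vector_mul_assoc [symmetric] matrix_vector_mult_diff_rdistrib
          matrix_vector_mult_diff_distrib vector_scalar_commute, simp add: matrix_vector_mul_assoc AP)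
    have "matpow (A - mat e) (Suc k) ** P' = ((A - mat e) ** P') ** matpow (J - mat e) k"
      by (simp add: Suc matrix_mul_assoc [symmetric])
    then show ?case by (simp add: * matrix_mul_assoc)
  qed simp
  have col: "P' *v axis a 1 \<in> ?G" for a
  proof -
    obtain j where j: "j < CARD('n)" "a = from_nat_into UNIV j" by (rule obtain_index)
    obtain n e where ne: "(n, e) \<in> set n_as" and
      0: "\<And>i. i < CARD('n) \<Longrightarrow> (jordan_matrix (map (\<lambda>(m, a). (m, a - e)) n_as) ^\<^sub>m n) $$ (i, j) = 0"
      using jordan_matrix_gen_eigenvector [of j n_as] j sum by auto
    have "jnf_mat (J - mat e) = jordan_matrix (map (\<lambda>(m, a). (m, a - e)) n_as)"
    proof (rule eq_matI)
      show dims: "dim_row (jnf_mat (J - mat e)) = dim_row (jordan_matrix (map (\<lambda>(m, a). (m, a - e)) n_as))"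
        "dim_col (jnf_mat (J - mat e)) = dim_col (jordan_matrix (map (\<lambda>(m, a). (m, a - e)) n_as))"
        using sum by (simp_all add: o_def case_prod_unfold)
      fix i j assume "i < dim_row (jordan_matrix (map (\<lambda>(m, a). (m, a - e)) n_as))"
        "j < dim_col (jordan_matrix (map (\<lambda>(m, a). (m, a - e)) n_as))"
      then have "i < CARD('n)" "j < CARD('n)" using dims by simp_all
      then show "jnf_mat (J - mat e) $$ (i, j) = jordan_matrix (map (\<lambda>(m, a). (m, a - e)) n_as) $$ (i, j)"
        using sum by (simp add: jordan_matrix_shift J [symmetric] jnf_mat_index mat_def index_eq_iff)
    qed
    then have 1: "jnf_mat (matpow (J - mat e) n) $$ (i, j) = 0" if "i < CARD('n)" for i
      using 0 [OF that] by (simp add: jnf_mat_matpow)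
    have "matpow (J - mat e) n $ b $ a = 0" for b
    proof -
      obtain i where "i < CARD('n)" "b = from_nat_into UNIV i" by (rule obtain_index)
      with 1 j show ?thesis by (simp add: jnf_mat_index)
    qed
    then have "matpow (J - mat e) n *v axis a 1 = 0"
      by (simp add: matrix_vector_mult_axis column_def vec_eq_iff)
    then have "matpow (A - mat e) n *v (P' *v axis a 1) = 0"
      by (simp add: matrix_vector_mul_assoc AP_pow)
        (simp add: matrix_vector_mul_assoc [symmetric])
    then show ?thesis using ne by blast
  qed
  have "v = P' *v (Q' *v v)"
    by (simp add: matrix_vector_mul_assoc PQ')
  also have "\<dots> = (\<Sum>a\<in>UNIV. (Q' *v v) $ a *s (P' *v axis a 1))"
    by (rule matrix_vector_mult_axis_eq)
  also have "\<dots> \<in> vec.span ?G"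
    by (intro vec.span_sum vec.span_scale vec.span_base col)
  finally show ?thesis .
qed

lemma jordan_nf_ex: "\<exists>n_as. jordan_nf (jnf_mat (A :: complex^'n^'n)) n_as"
  using char_poly_factorized [OF jnf_mat_carrier] jordan_nf_exists [OF jnf_mat_carrier] by blast

section \<open>Generalized eigenspaces\<close>

lemma matpow_vector_mult_zero_mono:
  assumes "matpow A m *v v = 0" "m \<le> n"
  shows "matpow A n *v v = (0 :: 'a::field^'n)"
proof -
  have "matpow A n *v v = matpow A (n - m) *v (matpow A m *v v)"
    using assms(2) by (simp add: matrix_vector_mul_assoc matpow_add [symmetric])
  then show ?thesis using assms(1) by simp
qed

lemma subspace_eq_matrix_vector:
  "vec.subspace {w. P *v w = (Q :: 'a::field^'n^'m) *v w}"
  by (auto simp: vec.subspace_def matrix_vector_right_distrib vector_scalar_commute)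

lemma poly_act_eigenvector:
  assumes "A *v v = l *s v"
  shows "poly_act A p v = poly p l *s v"
  by (induction p) (simp_all add: vector_scalar_commute assms vec.scale_left_distrib mult.commute)

text \<open>Otherwise the last nonzero vector of the chain would be an eigenvector for
  \<open>l\<close>.\<close>

lemma matpow_zero_imp_zero:
  assumes "l \<notin> spectrum \<Phi>" "matpow (cmat \<Phi> - mat l) k *v v = 0"
  shows "v = 0"
  using assms(2)
proof (induction k)
  case (Suc k)
  let ?w = "matpow (cmat \<Phi> - mat l) k *v v"
  have "cmat \<Phi> *v ?w = l *s ?w"
    using Suc.prems by (simp add: matrix_vector_mul_assoc [symmetric] matrix_vector_mult_diff_rdistrib)
  then have "?w = 0" using assms(1) by (auto simp: spectrum_def)
  then show ?case by (rule Suc.IH)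
qed simp

text \<open>The product of the factors \<open>(X - e)^N\<close> over the eigenvalues listed in a
  Jordan form annihilates the matrix, as it kills a spanning set. Applied to an eigenvector it
  multiplies by its value at the eigenvalue, so every eigenvalue is one of its finitely many
  roots.\<close>

lemma finite_spectrum: "finite (spectrum \<Phi>)" for \<Phi> :: "real^'n^'n"
proof -
  obtain n_as where jnf: "jordan_nf (jnf_mat (cmat \<Phi>)) n_as" using jordan_nf_ex by blast
  define p where "p = (\<Prod>e\<in>snd ` set n_as. [:- e, 1:] ^ CARD('n))"
  have "poly_act (cmat \<Phi>) p v = 0" for v
    using jordan_nf_span [OF jnf, of v]
  proof (induction rule: vec.span_induct)
    \<comment> \<open>In this induction rule \<open>base\<close> is closure under linear
      combinations and \<open>step\<close> treats the generators.\<close>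
    case base
    obtain M where "\<forall>v. poly_act (cmat \<Phi>) p v = M *v v" using poly_act_matrix by blast
    then show ?case
      using subspace_eq_matrix_vector [of M 0] by simp
  next
    case (step w)
    then obtain n e where ne: "(n, e) \<in> set n_as" "matpow (cmat \<Phi> - mat e) n *v w = 0" by blast
    then have e: "e \<in> snd ` set n_as" by force
    have "p = (\<Prod>e\<in>snd ` set n_as - {e}. [:- e, 1:] ^ CARD('n)) * [:- e, 1:] ^ CARD('n)"
      unfolding p_def by (subst prod.remove [OF _ e]) (simp_all add: mult.commute)
    moreover have "matpow (cmat \<Phi> - mat e) CARD('n) *v w = 0"
      using ne(2) jordan_nf_block_le [OF jnf ne(1)] by (rule matpow_vector_mult_zero_mono)
    ultimately show ?case by (simp add: poly_act_mult poly_act_linear_power)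
  qed
  then have "poly p l = 0" if "l \<in> spectrum \<Phi>" for l
    using that poly_act_eigenvector [of "cmat \<Phi>" _ l p] by (force simp: spectrum_def)
  then have "spectrum \<Phi> \<subseteq> snd ` set n_as"
    by (force simp: p_def poly_prod)
  then show ?thesis by (rule finite_subset) simp
qed

text \<open>The index is a maximum over all Jordan forms of the matrix, so every block of any one of
  them is a candidate, and the common bound on block sizes makes the maximum meaningful.\<close>

lemma eigen_index_bounds:
  fixes \<Phi> :: "real^'n^'n"
  assumes "jordan_nf (jnf_mat (cmat \<Phi>)) n_as" "(n, e) \<in> set n_as"
  shows "n \<le> eigen_index \<Phi> e" "eigen_index \<Phi> e \<le> CARD('n)"
proof -
  let ?S = "{n. \<exists>n_as. jordan_nf (jnf_mat (cmat \<Phi>)) n_as \<and> (n, e) \<in> set n_as}"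
  have "?S \<subseteq> {..CARD('n)}" using jordan_nf_block_le by blast
  then have fin: "finite ?S" by (rule finite_subset) simp
  have n: "n \<in> ?S" using assms by blast
  show "n \<le> eigen_index \<Phi> e" unfolding eigen_index_def by (rule Max_ge [OF fin n])
  have "eigen_index \<Phi> e \<in> ?S" unfolding eigen_index_def
    by (rule Max_in [OF fin]) (use n in blast)
  then show "eigen_index \<Phi> e \<le> CARD('n)" using \<open>?S \<subseteq> _\<close> by blast
qed

text \<open>The induction principle behind most later matrix facts. A generator comes with two
  exponents: the dimension, through \<open>gen_eigenspace\<close>, which suffices for projections
  and decay, and the sharper index, at which the chain on the unit circle must stop.\<close>

lemma eigen_index_induct:
  fixes \<Phi> :: "real^'n^'n"
  assumes S: "vec.subspace S"
    and gen: "\<And>e w. e \<in> spectrum \<Phi> \<Longrightarrow> w \<in> gen_eigenspace \<Phi> e \<Longrightarrow>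
      matpow (cmat \<Phi> - mat e) (eigen_index \<Phi> e) *v w = 0 \<Longrightarrow> w \<in> S"
  shows "v \<in> S"
proof -
  obtain n_as where jnf: "jordan_nf (jnf_mat (cmat \<Phi>)) n_as" using jordan_nf_ex by blast
  have "(\<Union>(n, e)\<in>set n_as. {w. matpow (cmat \<Phi> - mat e) n *v w = 0}) \<subseteq> S"
  proof clarify
    fix w n e assume ne: "(n, e) \<in> set n_as" and w: "matpow (cmat \<Phi> - mat e) n *v w = 0"
    show "w \<in> S"
    proof (cases "e \<in> spectrum \<Phi>")
      case True
      have d: "matpow (cmat \<Phi> - mat e) (eigen_index \<Phi> e) *v w = 0"
        using w eigen_index_bounds(1) [OF jnf ne] by (rule matpow_vector_mult_zero_mono)
      then have "w \<in> gen_eigenspace \<Phi> e"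
        using eigen_index_bounds(2) [OF jnf ne] by (auto simp: gen_eigenspace_def intro: matpow_vector_mult_zero_mono)
      then show ?thesis using gen True d by blast
    next
      case False
      \<comment> \<open>For \<open>e\<close> outside the spectrum \<open>cmat \<Phi> - mat e\<close>
        is injective, so the generator is zero.\<close>
      then have "w = 0" using w by (rule matpow_zero_imp_zero)
      then show ?thesis using S by (simp add: vec.subspace_0)
    qed
  qed
  then have "vec.span (\<Union>(n, e)\<in>set n_as. {w. matpow (cmat \<Phi> - mat e) n *v w = 0}) \<subseteq> S"
    using S by (rule vec.span_minimal)
  then show ?thesis using jordan_nf_span [OF jnf] by blast
qed

lemma matrix_eq_on_gen_eigenspaces:
  fixes \<Phi> :: "real^'n^'n"
  assumes "\<And>e w. e \<in> spectrum \<Phi> \<Longrightarrow> w \<in> gen_eigenspace \<Phi> e \<Longrightarrow>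
      matpow (cmat \<Phi> - mat e) (eigen_index \<Phi> e) *v w = 0 \<Longrightarrow> P *v w = Q *v w"
  shows "P = Q"
proof -
  from eigen_index_induct [OF subspace_eq_matrix_vector, of \<Phi> P Q] assms have "P *v v = Q *v v" for v by blast
  then show ?thesis by (simp add: matrix_eq)
qed

text \<open>In \<open>a * lin A + b * lin (spectrum \<Phi> - A) = 1\<close> the second summand is
  the projection: it contains a factor killing each generalized eigenspace outside \<open>A\<close>,
  and on those inside \<open>A\<close> the first summand vanishes, which leaves the
  identity.\<close>

lemma spectral_proj_ex:
  fixes \<Phi> :: "real^'n^'n"
  assumes "A \<subseteq> spectrum \<Phi>"
  shows "\<exists>P. (\<forall>v \<in> gen_eigenspace_sum \<Phi> A. P *v v = v) \<and>
     (\<forall>v \<in> gen_eigenspace_sum \<Phi> (spectrum \<Phi> - A). P *v v = 0)"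
proof -
  define lin where "lin S = (\<Prod>e\<in>S. [:- e, 1:] ^ CARD('n))" for S :: "complex set"
  have fin: "finite A" "finite (spectrum \<Phi> - A)"
    using finite_spectrum assms finite_subset by auto
  have "coprime (lin A) (lin (spectrum \<Phi> - A))"
    unfolding lin_def by (rule coprime_linear_factors) (use fin in auto)
  then obtain a b where ab: "a * lin A + b * lin (spectrum \<Phi> - A) = 1"
    using bezout_coefficients_fst_snd [of "lin A" "lin (spectrum \<Phi> - A)"]
    by (metis coprime_iff_gcd_eq_1)
  have lin_kills: "poly_act (cmat \<Phi>) (c * lin S) v = 0" if "finite S" "e \<in> S" "v \<in> gen_eigenspace \<Phi> e" for S e v c
  proof -
    have "lin S = lin (S - {e}) * [:- e, 1:] ^ CARD('n)"
      unfolding lin_def using that by (subst prod.remove [of _ e]) (simp_all add: mult.commute)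
    then show ?thesis
      using that(3) by (simp add: poly_act_mult poly_act_linear_power gen_eigenspace_def)
  qed
  obtain P where P: "\<And>v. poly_act (cmat \<Phi>) (b * lin (spectrum \<Phi> - A)) v = P *v v"
    using poly_act_matrix by metis
  have id: "P *v v = v" if "e \<in> A" "v \<in> gen_eigenspace \<Phi> e" for e v
  proof -
    have "v = poly_act (cmat \<Phi>) (a * lin A) v + P *v v"
      by (simp flip: P poly_act_add add: ab)
    then show ?thesis using lin_kills [OF fin(1) that] by simp
  qed
  have zero: "P *v v = 0" if "e \<in> spectrum \<Phi> - A" "v \<in> gen_eigenspace \<Phi> e" for e v
    unfolding P [symmetric] using fin(2) that by (rule lin_kills)
  have "gen_eigenspace_sum \<Phi> A \<subseteq> {v. P *v v = mat 1 *v v}"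
    unfolding gen_eigenspace_sum_def
    by (rule vec.span_minimal [OF _ subspace_eq_matrix_vector]) (auto simp: id)
  moreover have "gen_eigenspace_sum \<Phi> (spectrum \<Phi> - A) \<subseteq> {v. P *v v = 0 *v v}"
    unfolding gen_eigenspace_sum_def
    by (rule vec.span_minimal [OF _ subspace_eq_matrix_vector]) (auto simp: zero)
  ultimately show ?thesis by (intro exI [of _ P]) auto
qed

lemma gen_eigenspace_subset_sum: "e \<in> A \<Longrightarrow> gen_eigenspace \<Phi> e \<subseteq> gen_eigenspace_sum \<Phi> A"
  unfolding gen_eigenspace_sum_def using vec.span_superset by fastforce

text \<open>Resolves the \<open>THE\<close> once and for all: uniqueness holds because the
  generalized eigenspaces span. Everything later about \<open>spectral_proj\<close> is derived from
  this action.\<close>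

lemma spectral_proj_gen_eigenspace:
  assumes "A \<subseteq> spectrum \<Phi>" "e \<in> spectrum \<Phi>" "v \<in> gen_eigenspace \<Phi> e"
  shows "spectral_proj \<Phi> A *v v = (if e \<in> A then v else 0)"
proof -
  let ?spec = "\<lambda>P. (\<forall>v \<in> gen_eigenspace_sum \<Phi> A. P *v v = v) \<and>
     (\<forall>v \<in> gen_eigenspace_sum \<Phi> (spectrum \<Phi> - A). P *v v = 0)"
  have on_gen: "P *v w = (if e \<in> A then w else 0)"
    if "?spec P" "e \<in> spectrum \<Phi>" "w \<in> gen_eigenspace \<Phi> e" for P e w
    using that gen_eigenspace_subset_sum [of e A \<Phi>] gen_eigenspace_subset_sum [of e "spectrum \<Phi> - A" \<Phi>]
    by auto
  have "\<exists>!P. ?spec P"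
  proof (rule ex_ex1I)
    show "\<exists>P. ?spec P" using assms(1) by (rule spectral_proj_ex)
    show "P = Q" if "?spec P" "?spec Q" for P Q
      by (rule matrix_eq_on_gen_eigenspaces [of \<Phi>]) (simp only: on_gen [OF that(1)] on_gen [OF that(2)])
  qed
  from theI' [OF this] have "?spec (spectral_proj \<Phi> A)"
    unfolding spectral_proj_def .
  then show ?thesis using on_gen assms by blast
qed

section \<open>Real and complex matrices\<close>

lemma cvec_nth [simp]: "cvec v $ i = complex_of_real (v $ i)"
  by (simp add: cvec_def)

lemma cmat_nth [simp]: "cmat A $ i $ j = complex_of_real (A $ i $ j)"
  by (simp add: cmat_def map_matrix_def)

lemma cvec_inject [simp]: "cvec v = cvec w \<longleftrightarrow> v = w"
  by (simp add: vec_eq_iff)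

lemma cmat_inject [simp]: "cmat A = cmat B \<longleftrightarrow> A = B"
  by (simp add: vec_eq_iff)

lemma cvec_0 [simp]: "cvec 0 = 0" and cmat_0 [simp]: "cmat 0 = 0"
  by (simp_all add: vec_eq_iff)

lemma cvec_add: "cvec (v + w) = cvec v + cvec w"
  and cmat_add: "cmat (A + B) = cmat A + cmat B"
  by (simp_all add: vec_eq_iff)

lemma cvec_diff: "cvec (v - w) = cvec v - cvec w"
  by (simp add: vec_eq_iff)

lemma cmat_mat [simp]: "cmat (mat c) = mat (complex_of_real c)"
  by (simp add: vec_eq_iff mat_def)

lemma cmat_mult_cvec: "cvec (A *v v) = cmat A *v cvec v"
  by (simp add: vec_eq_iff matrix_vector_mult_def)

lemma cmat_mult: "cmat (A ** B) = cmat A ** cmat B"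
  by (simp add: vec_eq_iff matrix_matrix_mult_def)

lemma cmat_matpow: "cmat (matpow A k) = matpow (cmat A) k"
  by (induction k) (simp_all add: cmat_mult)

lemma norm_cvec [simp]: "norm (cvec v) = norm v"
  by (simp add: norm_vec_def)

lemma real_vec_cvec [simp]: "real_vec (cvec v) = v"
  by (simp add: real_vec_def)

section \<open>Complex conjugation and realness of the projections\<close>

definition cnj_vec :: "complex^'n \<Rightarrow> complex^'n" where
  "cnj_vec v = (\<chi> i. cnj (v $ i))"

lemma cnj_vec_nth [simp]: "cnj_vec v $ i = cnj (v $ i)"
  by (simp add: cnj_vec_def)

lemma cnj_vec_cnj_vec [simp]: "cnj_vec (cnj_vec v) = v"
  by (simp add: vec_eq_iff)

lemma cnj_vec_eq_0_iff [simp]: "cnj_vec v = 0 \<longleftrightarrow> v = 0"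
  by (simp add: vec_eq_iff)

text \<open>Conjugation commutes with the real matrix and conjugates the shift, hence swaps the
  generalized eigenspaces of \<open>e\<close> and \<open>cnj e\<close>.\<close>

lemma cnj_vec_mult:
  "(cmat \<Phi> - mat (cnj e)) *v cnj_vec v = cnj_vec ((cmat \<Phi> - mat e) *v v)"
  by (simp add: matrix_vector_mult_diff_rdistrib vec_eq_iff) (simp add: matrix_vector_mult_def)

lemma cnj_vec_matpow:
  "matpow (cmat \<Phi> - mat (cnj e)) k *v cnj_vec v = cnj_vec (matpow (cmat \<Phi> - mat e) k *v v)"
  by (induction k) (simp_all add: matrix_vector_mul_assoc [symmetric] cnj_vec_mult)

lemma cnj_gen_eigenspace: "v \<in> gen_eigenspace \<Phi> e \<Longrightarrow> cnj_vec v \<in> gen_eigenspace \<Phi> (cnj e)"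
  by (simp add: gen_eigenspace_def cnj_vec_matpow)

lemma cnj_spectrum: "e \<in> spectrum \<Phi> \<Longrightarrow> cnj e \<in> spectrum \<Phi>"
proof -
  have eig: "cmat \<Phi> *v v = l *s v \<longleftrightarrow> (cmat \<Phi> - mat l) *v v = 0" for l v
    by (simp add: matrix_vector_mult_diff_rdistrib)
  assume "e \<in> spectrum \<Phi>"
  then obtain v where "v \<noteq> 0" "(cmat \<Phi> - mat e) *v v = 0"
    by (auto simp: spectrum_def eig)
  then show ?thesis
    unfolding spectrum_def eig by (intro CollectI exI [of _ "cnj_vec v"]) (simp add: cnj_vec_mult)
qed

lemma cmat_real_mat:
  assumes "\<And>i j. cnj (M $ i $ j) = M $ i $ j"
  shows "cmat (real_mat M) = M"
proof -
  have "cmat (\<chi> i j. Re (M $ i $ j)) = M"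
    using assms by (simp add: vec_eq_iff complex_eq_iff)
  then have M: "M = cmat (\<chi> i j. Re (M $ i $ j))" ..
  show ?thesis by (subst (1 2) M) (simp add: real_mat_def)
qed

text \<open>The entrywise conjugate of the projection is conjugation, projection, conjugation. If
  \<open>A\<close> is closed under conjugation, this acts on each generalized eigenspace as the
  projection itself does.\<close>

lemma cmat_real_spectral_proj:
  assumes "A \<subseteq> spectrum \<Phi>" "\<And>e. e \<in> A \<Longrightarrow> cnj e \<in> A"
  shows "cmat (real_mat (spectral_proj \<Phi> A)) = spectral_proj \<Phi> A"
proof (rule cmat_real_mat)
  let ?P = "spectral_proj \<Phi> A"
  have "(\<chi> i j. cnj (?P $ i $ j)) = ?P"
  proof (rule matrix_eq_on_gen_eigenspaces [of \<Phi>])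
    fix e w assume e: "e \<in> spectrum \<Phi>" and w: "w \<in> gen_eigenspace \<Phi> e"
    have "(\<chi> i j. cnj (?P $ i $ j)) *v w = cnj_vec (?P *v cnj_vec w)"
      by (simp add: vec_eq_iff matrix_vector_mult_def)
    also have "\<dots> = (if cnj e \<in> A then w else 0)"
      using assms(1) cnj_spectrum [OF e] cnj_gen_eigenspace [OF w]
      by (simp add: spectral_proj_gen_eigenspace)
    also have "\<dots> = ?P *v w"
      \<comment> \<open>The two instances of the closure assumption give
        \<open>cnj e \<in> A\<close> if and only if \<open>e \<in> A\<close>.\<close>
      using spectral_proj_gen_eigenspace [OF assms(1) e w] assms(2) [of e] assms(2) [of "cnj e"] by auto
    finally show "(\<chi> i j. cnj (?P $ i $ j)) *v w = ?P *v w" .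
  qed
  then show "cnj (?P $ i $ j) = ?P $ i $ j" for i j
    by (simp add: vec_eq_iff)
qed

section \<open>Spectral projections\<close>

lemma gen_eigenspace_invariant:
  assumes "w \<in> gen_eigenspace \<Phi> e"
  shows "cmat \<Phi> *v w \<in> gen_eigenspace \<Phi> e"
proof -
  have "(cmat \<Phi> - mat e) ** cmat \<Phi> = cmat \<Phi> ** (cmat \<Phi> - mat e)"
    by (rule matrix_eq [THEN iffD2])
      (simp add: matrix_vector_mul_assoc [symmetric] matrix_vector_mult_diff_rdistrib
        matrix_vector_mult_diff_distrib vector_scalar_commute)
  then show ?thesis
    using assms unfolding gen_eigenspace_def mem_Collect_eq
    by (metis matpow_commute matrix_vector_mul_assoc matrix_vector_mult_0_right)
qed

lemma spectral_proj_commute: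
  assumes "A \<subseteq> spectrum \<Phi>"
  shows "spectral_proj \<Phi> A ** cmat \<Phi> = cmat \<Phi> ** spectral_proj \<Phi> A"
proof (rule matrix_eq_on_gen_eigenspaces [of \<Phi>])
  fix e w assume ew: "e \<in> spectrum \<Phi>" "w \<in> gen_eigenspace \<Phi> e"
  then have "cmat \<Phi> *v w \<in> gen_eigenspace \<Phi> e"
    by (intro gen_eigenspace_invariant)
  then show "(spectral_proj \<Phi> A ** cmat \<Phi>) *v w = (cmat \<Phi> ** spectral_proj \<Phi> A) *v w"
    using assms ew by (simp add: matrix_vector_mul_assoc [symmetric] spectral_proj_gen_eigenspace)
qed

lemma spectral_proj_mult:
  assumes "A \<subseteq> spectrum \<Phi>" "B \<subseteq> spectrum \<Phi>"
  shows "spectral_proj \<Phi> A ** spectral_proj \<Phi> B = spectral_proj \<Phi> (A \<inter> B)"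
proof -
  have AB: "A \<inter> B \<subseteq> spectrum \<Phi>" using assms by blast
  show ?thesis
    by (rule matrix_eq_on_gen_eigenspaces [of \<Phi>])
      (simp add: matrix_vector_mul_assoc [symmetric] spectral_proj_gen_eigenspace assms AB)
qed

lemma spectral_proj_Un:
  assumes "A \<subseteq> spectrum \<Phi>" "B \<subseteq> spectrum \<Phi>" "A \<inter> B = {}"
  shows "spectral_proj \<Phi> (A \<union> B) = spectral_proj \<Phi> A + spectral_proj \<Phi> B"
proof -
  have AB: "A \<union> B \<subseteq> spectrum \<Phi>" using assms by blast
  have disj: "e \<notin> B" if "e \<in> A" for e using that assms(3) by blast
  show ?thesis
    by (rule matrix_eq_on_gen_eigenspaces [of \<Phi>])
      (auto simp: matrix_vector_mult_add_rdistrib spectral_proj_gen_eigenspace assms AB dest: disj)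
qed

lemma spectral_proj_spectrum: "spectral_proj \<Phi> (spectrum \<Phi>) = mat 1"
  by (rule matrix_eq_on_gen_eigenspaces [of \<Phi>]) (simp add: spectral_proj_gen_eigenspace)

lemma spectral_proj_empty: "spectral_proj \<Phi> {} = 0"
  by (rule matrix_eq_on_gen_eigenspaces [of \<Phi>]) (simp add: spectral_proj_gen_eigenspace)

lemma spectral_proj_sum:
  assumes "finite I" "inj_on f I" "f ` I \<subseteq> spectrum \<Phi>"
  shows "(\<Sum>i\<in>I. spectral_proj \<Phi> {f i}) = spectral_proj \<Phi> (f ` I)"
  using assms
proof (induction I)
  case (insert i I)
  have "spectral_proj \<Phi> ({f i} \<union> f ` I) = spectral_proj \<Phi> {f i} + spectral_proj \<Phi> (f ` I)"
    by (rule spectral_proj_Un) (use insert in auto)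
  then show ?case using insert by auto
qed (simp add: spectral_proj_empty)

text \<open>Here the index exponent of \<open>matrix_eq_on_gen_eigenspaces\<close> is put to work:
  the spanning vectors for \<open>e\<close> are already killed by that power, the others by the
  projection.\<close>

lemma spectral_proj_nilpotent:
  assumes "e \<in> spectrum \<Phi>"
  shows "matpow (cmat \<Phi> - mat e) (eigen_index \<Phi> e) ** spectral_proj \<Phi> {e} = 0"
proof (rule matrix_eq_on_gen_eigenspaces [of \<Phi>])
  fix e' w assume "e' \<in> spectrum \<Phi>" "w \<in> gen_eigenspace \<Phi> e'"
    "matpow (cmat \<Phi> - mat e') (eigen_index \<Phi> e') *v w = 0"
  then show "(matpow (cmat \<Phi> - mat e) (eigen_index \<Phi> e) ** spectral_proj \<Phi> {e}) *v w = 0 *v w"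
    using assms by (auto simp: matrix_vector_mul_assoc [symmetric] spectral_proj_gen_eigenspace)
qed

lemma cmat_projections:
  "cmat (P_zero \<Phi>) = spectral_proj \<Phi> {l \<in> spectrum \<Phi>. l = 0}"
  "cmat (P_less1 \<Phi>) = spectral_proj \<Phi> {l \<in> spectrum \<Phi>. cmod l < 1}"
  "cmat (P_right \<Phi>) = spectral_proj \<Phi> {l \<in> spectrum \<Phi>. 0 < cmod l \<and> cmod l < 1}"
  "cmat (P_left \<Phi>) = spectral_proj \<Phi> {l \<in> spectrum \<Phi>. cmod l > 1}"
  "cmat (P_unit \<Phi>) = spectral_proj \<Phi> {l \<in> spectrum \<Phi>. cmod l = 1}"
  unfolding P_zero_def P_less1_def P_right_def P_left_def P_unit_def
  by (rule cmat_real_spectral_proj; use cnj_spectrum in auto)+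

lemma P_less1_eq: "P_less1 \<Phi> = P_zero \<Phi> + P_right \<Phi>"
proof -
  have "{l \<in> spectrum \<Phi>. cmod l < 1}
      = {l \<in> spectrum \<Phi>. l = 0} \<union> {l \<in> spectrum \<Phi>. 0 < cmod l \<and> cmod l < 1}" by auto
  then have "cmat (P_less1 \<Phi>) = cmat (P_zero \<Phi> + P_right \<Phi>)"
    unfolding cmat_add cmat_projections by (simp only:) (rule spectral_proj_Un; auto)
  then show ?thesis by simp
qed

lemma projections_sum: "P_zero \<Phi> + P_right \<Phi> + P_left \<Phi> + P_unit \<Phi> = mat 1"
proof -
  have "{l \<in> spectrum \<Phi>. cmod l < 1} \<union> {l \<in> spectrum \<Phi>. cmod l > 1} \<union> {l \<in> spectrum \<Phi>. cmod l = 1}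
      = spectrum \<Phi>" by auto
  then have "spectral_proj \<Phi> ({l \<in> spectrum \<Phi>. cmod l < 1} \<union> {l \<in> spectrum \<Phi>. cmod l > 1}
      \<union> {l \<in> spectrum \<Phi>. cmod l = 1}) = mat 1"
    by (simp add: spectral_proj_spectrum)
  moreover have "spectral_proj \<Phi> ({l \<in> spectrum \<Phi>. cmod l < 1} \<union> {l \<in> spectrum \<Phi>. cmod l > 1}
      \<union> {l \<in> spectrum \<Phi>. cmod l = 1})
    = cmat (P_less1 \<Phi>) + cmat (P_left \<Phi>) + cmat (P_unit \<Phi>)"
    unfolding cmat_projections by (subst spectral_proj_Un; auto)+
  ultimately have "cmat (P_less1 \<Phi> + P_left \<Phi> + P_unit \<Phi>) = cmat (mat 1)"
    by (simp add: cmat_add)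
  then show ?thesis by (simp only: cmat_inject P_less1_eq)
qed

lemma projections_mult:
  "P_zero \<Phi> ** P_zero \<Phi> = P_zero \<Phi>" "P_right \<Phi> ** P_right \<Phi> = P_right \<Phi>"
  "P_left \<Phi> ** P_left \<Phi> = P_left \<Phi>" "P_unit \<Phi> ** P_unit \<Phi> = P_unit \<Phi>"
  "P_zero \<Phi> ** P_right \<Phi> = 0" "P_zero \<Phi> ** P_left \<Phi> = 0" "P_zero \<Phi> ** P_unit \<Phi> = 0"
  "P_right \<Phi> ** P_zero \<Phi> = 0" "P_right \<Phi> ** P_left \<Phi> = 0" "P_right \<Phi> ** P_unit \<Phi> = 0"
  "P_left \<Phi> ** P_zero \<Phi> = 0" "P_left \<Phi> ** P_right \<Phi> = 0" "P_left \<Phi> ** P_unit \<Phi> = 0"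
  "P_unit \<Phi> ** P_zero \<Phi> = 0" "P_unit \<Phi> ** P_right \<Phi> = 0" "P_unit \<Phi> ** P_left \<Phi> = 0"
proof -
  have eq: "A ** B = C" if "cmat A = spectral_proj \<Phi> S" "cmat B = spectral_proj \<Phi> T"
    "S \<subseteq> spectrum \<Phi>" "T \<subseteq> spectrum \<Phi>" "cmat C = spectral_proj \<Phi> (S \<inter> T)" for A B C S T
  proof -
    have "cmat (A ** B) = cmat C" using that by (simp add: cmat_mult spectral_proj_mult)
    then show ?thesis by simp
  qed
  have zero: "cmat 0 = spectral_proj \<Phi> (S \<inter> T)" if "S \<inter> T = {}" for S T
    using that by (simp add: spectral_proj_empty)
  have same: "cmat C = spectral_proj \<Phi> (S \<inter> S)" if "cmat C = spectral_proj \<Phi> S" for C S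
    using that by simp
  show
    "P_zero \<Phi> ** P_zero \<Phi> = P_zero \<Phi>" "P_right \<Phi> ** P_right \<Phi> = P_right \<Phi>"
    "P_left \<Phi> ** P_left \<Phi> = P_left \<Phi>" "P_unit \<Phi> ** P_unit \<Phi> = P_unit \<Phi>"
    by (rule eq [OF _ _ _ _ same]; (rule cmat_projections)?; auto)+
  show
    "P_zero \<Phi> ** P_right \<Phi> = 0" "P_zero \<Phi> ** P_left \<Phi> = 0" "P_zero \<Phi> ** P_unit \<Phi> = 0"
    "P_right \<Phi> ** P_zero \<Phi> = 0" "P_right \<Phi> ** P_left \<Phi> = 0" "P_right \<Phi> ** P_unit \<Phi> = 0"
    "P_left \<Phi> ** P_zero \<Phi> = 0" "P_left \<Phi> ** P_right \<Phi> = 0" "P_left \<Phi> ** P_unit \<Phi> = 0"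
    "P_unit \<Phi> ** P_zero \<Phi> = 0" "P_unit \<Phi> ** P_right \<Phi> = 0" "P_unit \<Phi> ** P_left \<Phi> = 0"
    by (rule eq [OF _ _ _ _ zero]; (rule cmat_projections)?; auto)+
qed

lemma projections_commute:
  "P_zero \<Phi> ** \<Phi> = \<Phi> ** P_zero \<Phi>" "P_right \<Phi> ** \<Phi> = \<Phi> ** P_right \<Phi>"
  "P_left \<Phi> ** \<Phi> = \<Phi> ** P_left \<Phi>" "P_unit \<Phi> ** \<Phi> = \<Phi> ** P_unit \<Phi>"
proof -
  have eq: "A ** \<Phi> = \<Phi> ** A" if "cmat A = spectral_proj \<Phi> S" "S \<subseteq> spectrum \<Phi>" for A S
  proof -
    have "cmat (A ** \<Phi>) = cmat (\<Phi> ** A)" using that by (simp add: cmat_mult spectral_proj_commute)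
    then show ?thesis by simp
  qed
  show "P_zero \<Phi> ** \<Phi> = \<Phi> ** P_zero \<Phi>" "P_right \<Phi> ** \<Phi> = \<Phi> ** P_right \<Phi>"
    "P_left \<Phi> ** \<Phi> = \<Phi> ** P_left \<Phi>" "P_unit \<Phi> ** \<Phi> = \<Phi> ** P_unit \<Phi>"
    by (rule eq, rule cmat_projections, auto)+
qed

lemma matpow_P_zero: "matpow \<Phi> CARD('n) ** P_zero \<Phi> = 0" for \<Phi> :: "real^'n^'n"
proof -
  have "matpow (cmat \<Phi>) CARD('n) ** spectral_proj \<Phi> {l \<in> spectrum \<Phi>. l = 0} = 0"
  proof (rule matrix_eq_on_gen_eigenspaces [of \<Phi>])
    fix e w assume "e \<in> spectrum \<Phi>" "w \<in> gen_eigenspace \<Phi> e"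
    moreover have "{l \<in> spectrum \<Phi>. l = 0} \<subseteq> spectrum \<Phi>" by blast
    ultimately show "(matpow (cmat \<Phi>) CARD('n) ** spectral_proj \<Phi> {l \<in> spectrum \<Phi>. l = 0}) *v w = 0 *v w"
      by (auto simp: matrix_vector_mul_assoc [symmetric] spectral_proj_gen_eigenspace gen_eigenspace_def)
  qed
  then have "cmat (matpow \<Phi> CARD('n) ** P_zero \<Phi>) = cmat 0"
    by (simp add: cmat_mult cmat_matpow cmat_projections)
  then show ?thesis by (simp only: cmat_inject)
qed

text \<open>Together with \<open>matpow_P_zero\<close> this identifies the range of
  \<open>P_zero \<Phi>\<close> with the kernel of \<open>matpow \<Phi> CARD('n)\<close>. Membership
  in that range can thus be tested by real matrix algebra.\<close>

lemma P_zero_fixes_kernel: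
  fixes \<Phi> :: "real^'n^'n"
  assumes "matpow \<Phi> CARD('n) *v v = 0"
  shows "P_zero \<Phi> *v v = v"
proof -
  have 0: "matpow (cmat \<Phi>) CARD('n) *v cvec v = 0"
    using assms by (metis cmat_matpow cmat_mult_cvec cvec_0)
  show ?thesis
  proof (cases "0 \<in> spectrum \<Phi>")
    case True
    have "cmat (P_zero \<Phi>) *v cvec v = cvec v"
      unfolding cmat_projections using True 0
      by (subst spectral_proj_gen_eigenspace [of _ _ 0]) (auto simp: gen_eigenspace_def)
    then show ?thesis by (metis cmat_mult_cvec cvec_inject)
  next
    case False
    then have "cvec v = 0" by (rule matpow_zero_imp_zero) (use 0 in simp)
    then have "v = 0" by (metis cvec_0 cvec_inject)
    then show ?thesis by simp
  qed
qed

section \<open>The Drazin inverse\<close>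

lemma matrix_diff_ldistrib: "A ** (B - C) = A ** B - A ** (C :: 'a::field^'n^'m)"
  by (rule matrix_eq [THEN iffD2])
    (simp add: matrix_vector_mul_assoc [symmetric] matrix_vector_mult_diff_rdistrib
      matrix_vector_mult_diff_distrib)

lemma matrix_diff_rdistrib: "(A - B) ** C = A ** C - B ** (C :: 'a::field^'n^'m)"
  by (rule matrix_eq [THEN iffD2])
    (simp add: matrix_vector_mul_assoc [symmetric] matrix_vector_mult_diff_rdistrib)

lemma matrix_add_rdistrib: "(A + B) ** C = A ** C + B ** (C :: 'a::field^'n^'m)"
  by (rule matrix_eq [THEN iffD2])
    (simp add: matrix_vector_mul_assoc [symmetric] matrix_vector_mult_add_rdistrib)

text \<open>The predicate under the \<open>THE\<close> of \<open>drazin_inverse\<close>, named so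
  that existence and uniqueness can be treated apart.\<close>

definition is_drazin :: "real^'n^'n \<Rightarrow> real^'n^'n \<Rightarrow> bool" where
  "is_drazin A D \<longleftrightarrow> D ** A ** D = D \<and> D ** A = A ** D
     \<and> D ** matpow A (CARD('n) + 1) = matpow A CARD('n)"

text \<open>Write \<open>P\<close> for \<open>P_zero \<Phi>\<close> and \<open>N\<close> for the
  dimension. Since \<open>D\<close> factors through \<Phi>^N on the left, \<open>P ** D = 0\<close>.
  Since \<Phi>^N kills \<open>D ** \<Phi> - mat 1\<close>, this difference is fixed by
  \<open>P\<close>; but \<open>P\<close> also maps it to \<open>- P\<close>, so the two agree. The
  equations hold for every candidate \<open>D\<close>, which yields uniqueness as well.\<close>

lemma is_drazin_props:
  fixes \<Phi> :: "real^'n^'n"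
  assumes "is_drazin \<Phi> D"
  shows "D ** \<Phi> = mat 1 - P_zero \<Phi>" "\<Phi> ** D = mat 1 - P_zero \<Phi>"
    "P_zero \<Phi> ** D = 0" "D ** P_zero \<Phi> = 0"
proof -
  let ?N = "CARD('n)"
  have DAD: "D ** \<Phi> ** D = D" and comm: "D ** \<Phi> = \<Phi> ** D"
    and pow: "D ** matpow \<Phi> (?N + 1) = matpow \<Phi> ?N"
    using assms unfolding is_drazin_def by blast+
  have D: "D = matpow \<Phi> k ** (matpow D k ** D)" for k
  proof (induction k)
    case (Suc k)
    have "matpow \<Phi> (Suc k) ** (matpow D (Suc k) ** D)
        = matpow \<Phi> k ** ((\<Phi> ** D) ** (matpow D k ** D))"
      by (simp only: matpow_Suc2 [of \<Phi>] matpow.simps(2) [of D] matrix_mul_assoc)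
    also have "(\<Phi> ** D) ** (matpow D k ** D) = (D ** \<Phi> ** D) ** matpow D k"
      by (simp add: matpow_commute comm matrix_mul_assoc)
    also have "\<dots> = matpow D k ** D"
      by (simp add: DAD matpow_commute)
    finally show ?case using Suc.IH by simp
  qed simp
  have "P_zero \<Phi> ** matpow \<Phi> ?N = 0"
    using matpow_P_zero [of \<Phi>] matpow_commute [OF projections_commute(1) [of \<Phi>, symmetric], of ?N] by simp
  then show PD: "P_zero \<Phi> ** D = 0"
    by (subst D [of ?N]) (simp add: matrix_mul_assoc)
  have eq: "P_zero \<Phi> *v ((D ** \<Phi> - mat 1) *v v) = (D ** \<Phi> - mat 1) *v v" for v
  proof (rule P_zero_fixes_kernel)
    have "matpow \<Phi> ?N ** (D ** \<Phi>) = D ** matpow \<Phi> (?N + 1)"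
      using matpow_commute [OF comm [symmetric], of ?N] by (simp add: matrix_mul_assoc matpow_Suc2 del: matpow.simps)
    then have "matpow \<Phi> ?N ** (D ** \<Phi> - mat 1) = 0"
      unfolding pow by (simp add: matrix_diff_ldistrib)
    then show "matpow \<Phi> ?N *v ((D ** \<Phi> - mat 1) *v v) = 0"
      by (simp add: matrix_vector_mul_assoc)
  qed
  have "P_zero \<Phi> ** (D ** \<Phi> - mat 1) = D ** \<Phi> - mat 1"
    by (rule matrix_eq [THEN iffD2]) (simp add: eq matrix_vector_mul_assoc [symmetric] del: mat_vector_mult)
  moreover have "P_zero \<Phi> ** (D ** \<Phi> - mat 1) = - P_zero \<Phi>"
    by (simp add: matrix_diff_ldistrib matrix_mul_assoc PD)
  ultimately show *: "D ** \<Phi> = mat 1 - P_zero \<Phi>"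
    by (simp add: algebra_simps)
  then show "\<Phi> ** D = mat 1 - P_zero \<Phi>" by (simp add: comm)
  have "D ** P_zero \<Phi> = D ** ((D ** \<Phi>) ** P_zero \<Phi>)"
    using DAD comm by (metis matrix_mul_assoc)
  also have "(D ** \<Phi>) ** P_zero \<Phi> = 0"
    by (simp add: * matrix_diff_rdistrib projections_mult)
  finally show "D ** P_zero \<Phi> = 0" by simp
qed

lemma is_drazin_ex:
  fixes \<Phi> :: "real^'n^'n"
  shows "\<exists>D. is_drazin \<Phi> D"
proof -
  let ?N = "CARD('n)"
  define P where "P = P_zero \<Phi>"
  \<comment> \<open>On the range of \<open>P\<close> this is identity plus nilpotent, and on its
    kernel it is \<Phi>, which is injective there. So \<open>M\<close> is invertible, and its
    inverse cut down by \<open>E\<close> is the Drazin inverse.\<close>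
  define M where "M = \<Phi> + P"
  define E where "E = mat 1 - P"
  have PP: "P ** P = P" and P_comm: "P ** \<Phi> = \<Phi> ** P"
    by (simp_all add: P_def projections_mult projections_commute)
  have pow_P: "matpow \<Phi> ?N ** P = 0" by (simp add: P_def matpow_P_zero)
  \<comment> \<open>If \<open>M\<close> kills \<open>v\<close>, then \<Phi> acts as -1 on
    \<open>P *v v\<close>, where it is also nilpotent; so this vector is 0. Then \<Phi> kills
    \<open>v\<close>, which forces \<open>v\<close> into the range of \<open>P\<close>.\<close>
  have "v = 0" if "M *v v = 0" for v
  proof -
    let ?w = "P *v v"
    have "\<Phi> *v ?w + ?w = P *v (M *v v)"
      by (simp add: M_def matrix_vector_mult_add_rdistrib matrix_vector_right_distrib
          matrix_vector_mul_assoc PP P_comm)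
    then have \<Phi>w: "\<Phi> *v ?w = (-1) *s ?w" using that by (simp add: eq_neg_iff_add_eq_0)
    have "matpow \<Phi> k *v ?w = (-1) ^ k *s ?w" for k
    proof (induction k)
      case (Suc k)
      have "matpow \<Phi> (Suc k) *v ?w = matpow \<Phi> k *v (\<Phi> *v ?w)"
        by (simp only: matpow_Suc2 matrix_vector_mul_assoc [symmetric])
      also have "\<dots> = (-1) *s ((-1) ^ k *s ?w)"
        by (simp only: \<Phi>w vector_scalar_commute Suc.IH)
      finally show ?case by (simp only: vec.scale_scale power_Suc)
    qed simp
    moreover have "matpow \<Phi> ?N *v ?w = 0"
      by (simp add: matrix_vector_mul_assoc pow_P)
    ultimately have "(-1) ^ ?N *s ?w = 0" by metis
    then have w: "?w = 0" by (simp add: vec_eq_iff)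
    then have "\<Phi> *v v = 0" using that by (simp add: M_def matrix_vector_mult_add_rdistrib)
    moreover have "?N = Suc (?N - 1)" by simp
    ultimately have "matpow \<Phi> ?N *v v = 0"
      by (metis matpow_Suc2 matrix_vector_mul_assoc matrix_vector_mult_0_right)
    then have "P *v v = v" unfolding P_def by (rule P_zero_fixes_kernel)
    then show ?thesis using w by simp
  qed
  then obtain K where KM: "K ** M = mat 1"
    using matrix_left_invertible_ker [of M] by blast
  then have MK: "M ** K = mat 1" by (simp add: matrix_left_right_inverse)
  have K_comm: "K ** B = B ** K" if "M ** B = B ** M" for B
  proof -
    have "K ** B = K ** B ** (M ** K)" by (simp add: MK)
    also have "\<dots> = K ** (M ** B) ** K" using that by (simp add: matrix_mul_assoc)
    also have "\<dots> = B ** K" by (simp add: matrix_mul_assoc KM)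
    finally show ?thesis .
  qed
  have E\<Phi>: "E ** \<Phi> = \<Phi> ** E"
    by (simp add: E_def matrix_diff_ldistrib matrix_diff_rdistrib P_comm)
  have EE: "E ** E = E"
    by (simp add: E_def matrix_diff_ldistrib matrix_diff_rdistrib PP)
  have ME: "M ** E = \<Phi> ** E" and EM: "E ** M = \<Phi> ** E"
    by (simp_all add: M_def E_def matrix_diff_ldistrib matrix_diff_rdistrib matrix_add_ldistrib
        matrix_add_rdistrib PP P_comm)
  have M\<Phi>: "M ** \<Phi> = \<Phi> ** M"
    by (simp add: M_def matrix_add_ldistrib matrix_add_rdistrib P_comm)
  have KE: "K ** E = E ** K" using ME EM by (intro K_comm) simp
  have K\<Phi>: "K ** \<Phi> = \<Phi> ** K" using M\<Phi> by (rule K_comm)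
  define D where "D = E ** K"
  have D\<Phi>: "D ** \<Phi> = E"
  proof -
    have "D ** \<Phi> = K ** (E ** \<Phi>)" by (simp add: D_def KE [symmetric] matrix_mul_assoc)
    also have "\<dots> = (K ** M) ** E" by (simp add: E\<Phi> ME [symmetric] matrix_mul_assoc)
    finally show ?thesis by (simp add: KM)
  qed
  have \<Phi>D: "\<Phi> ** D = E"
  proof -
    have "\<Phi> ** D = E ** (M ** K)" by (simp add: D_def matrix_mul_assoc EM)
    then show ?thesis by (simp add: MK)
  qed
  have "D ** \<Phi> ** D = D" by (simp add: D\<Phi>) (simp add: D_def matrix_mul_assoc EE)
  moreover have "D ** matpow \<Phi> (?N + 1) = matpow \<Phi> ?N"
  proof -
    have "D ** matpow \<Phi> (?N + 1) = E ** matpow \<Phi> ?N" by (simp add: matrix_mul_assoc D\<Phi>)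
    also have "\<dots> = matpow \<Phi> ?N ** E" by (simp add: matpow_commute E\<Phi>)
    also have "\<dots> = matpow \<Phi> ?N" by (simp add: E_def matrix_diff_ldistrib pow_P)
    finally show ?thesis .
  qed
  ultimately show ?thesis using D\<Phi> \<Phi>D by (auto simp: is_drazin_def)
qed

lemma is_drazin_unique:
  assumes "is_drazin \<Phi> D" "is_drazin \<Phi> D'"
  shows "D = D'"
proof -
  note p = is_drazin_props [OF assms(1)] and q = is_drazin_props [OF assms(2)]
  have "D = D ** (mat 1 - P_zero \<Phi>)" by (simp add: matrix_diff_ldistrib p)
  also have "\<dots> = (D ** \<Phi>) ** D'" by (simp add: q(2) [symmetric] matrix_mul_assoc)
  also have "\<dots> = D'" by (simp add: p(1) matrix_diff_rdistrib q)
  finally show ?thesis .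
qed

lemma is_drazin_drazin_inverse: "is_drazin \<Phi> (drazin_inverse \<Phi>)"
proof -
  have "\<exists>!D. is_drazin \<Phi> D" using is_drazin_ex is_drazin_unique by blast
  then have "\<exists>!D. D ** \<Phi> ** D = D \<and> D ** \<Phi> = \<Phi> ** D \<and> D ** matpow \<Phi> (CARD('a) + 1) = matpow \<Phi> CARD('a)"
    unfolding is_drazin_def .
  from theI' [OF this] show ?thesis unfolding is_drazin_def drazin_inverse_def .
qed

lemmas drazin_inverse_props = is_drazin_props [OF is_drazin_drazin_inverse]

section \<open>Geometric decay\<close>

text \<open>Constant and rate are existentially quantified, so that the vectors with decaying orbits
  form a subspace. The rate is positive in order to match the weights in
  \<open>subexponential\<close>.\<close>

definition geo_decay :: "(nat \<Rightarrow> 'a::real_normed_vector) \<Rightarrow> bool" where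
  "geo_decay f \<longleftrightarrow> (\<exists>C r. 0 < r \<and> r < 1 \<and> (\<forall>k. norm (f k) \<le> C * r ^ k))"

lemma geo_decayI:
  "0 < r \<Longrightarrow> r < 1 \<Longrightarrow> (\<And>k. norm (f k) \<le> C * r ^ k) \<Longrightarrow> geo_decay f"
  by (auto simp: geo_decay_def)

lemma geo_decay_0: "geo_decay (\<lambda>_. 0)"
  by (rule geo_decayI [of "1/2" _ 0]) simp_all

lemma geo_decay_add:
  assumes "geo_decay f" "geo_decay g"
  shows "geo_decay (\<lambda>k. f k + g k)"
proof -
  obtain C r where f: "0 < r" "r < 1" "\<And>k. norm (f k) \<le> C * r ^ k"
    using assms(1) by (auto simp: geo_decay_def)
  obtain C' r' where g: "0 < r'" "r' < 1" "\<And>k. norm (g k) \<le> C' * r' ^ k"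
    using assms(2) by (auto simp: geo_decay_def)
  have C: "0 \<le> C" "0 \<le> C'"
    using order_trans [OF norm_ge_zero f(3) [of 0]] order_trans [OF norm_ge_zero g(3) [of 0]] by simp_all
  show ?thesis
  proof (rule geo_decayI [of "max r r'" _ "C + C'"])
    fix k
    have "norm (f k + g k) \<le> C * r ^ k + C' * r' ^ k"
      using norm_triangle_ineq [of "f k" "g k"] f(3) [of k] g(3) [of k] by linarith
    also have "\<dots> \<le> C * max r r' ^ k + C' * max r r' ^ k"
      using C f(1) g(1) by (intro add_mono mult_left_mono power_mono) auto
    finally show "norm (f k + g k) \<le> (C + C') * max r r' ^ k" by (simp add: algebra_simps)
  qed (use f g in auto)
qed

lemma geo_decay_bound:
  assumes "geo_decay f" "\<And>k. norm (g k) \<le> c * norm (f k)"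
  shows "geo_decay g"
proof -
  obtain C r where f: "0 < r" "r < 1" "\<And>k. norm (f k) \<le> C * r ^ k"
    using assms(1) by (auto simp: geo_decay_def)
  show ?thesis
  proof (rule geo_decayI [OF f(1,2)])
    fix k
    have "norm (g k) \<le> \<bar>c\<bar> * norm (f k)"
      using assms(2) [of k] by (meson abs_ge_self mult_right_mono norm_ge_zero order_trans)
    also have "\<dots> \<le> \<bar>c\<bar> * (C * r ^ k)"
      using f(3) by (intro mult_left_mono) auto
    finally show "norm (g k) \<le> (\<bar>c\<bar> * C) * r ^ k" by (simp add: mult.assoc)
  qed
qed

text \<open>Replaces an estimate of the powers of a Jordan block: a decaying input \<open>b\<close>
  does not spoil a contraction by \<rho>, at the price of a slightly larger rate.\<close>

lemma geo_decay_recurrence: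
  assumes "geo_decay b" "0 \<le> \<rho>" "\<rho> < 1"
    and rec: "\<And>k. norm (a (Suc k)) \<le> \<rho> * norm (a k) + norm (b k)"
  shows "geo_decay a"
proof -
  obtain C s where b: "0 < s" "s < 1" "\<And>k. norm (b k) \<le> C * s ^ k"
    using assms(1) by (auto simp: geo_decay_def)
  have C: "0 \<le> C" using order_trans [OF norm_ge_zero b(3) [of 0]] by simp
  \<comment> \<open>The midpoint of \<rho> and 1 keeps \<open>r\<close> strictly above \<rho> and
    below 1; the gap \<open>r - \<rho>\<close> has to pay for the input.\<close>
  define r where "r = max s ((1 + \<rho>) / 2)"
  have r: "0 < r" "r < 1" "s \<le> r" "\<rho> < r"
    using b assms(2,3) by (auto simp: r_def less_max_iff_disj)
  \<comment> \<open>The induction step needs \<open>\<rho> * K + C \<le> r * K\<close>, that is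
    \<open>K \<ge> C / (r - \<rho>)\<close>.\<close>
  define K where "K = max (norm (a 0)) (C / (r - \<rho>))"
  have "norm (a k) \<le> K * r ^ k" for k
  proof (induction k)
    case 0
    show ?case by (simp add: K_def)
  next
    case (Suc k)
    have "C / (r - \<rho>) \<le> K" by (simp add: K_def)
    then have CK: "C \<le> K * (r - \<rho>)" using r by (simp add: pos_divide_le_eq)
    have "norm (b k) \<le> C * s ^ k" by (rule b(3))
    also have "\<dots> \<le> C * r ^ k" using C r b by (intro mult_left_mono power_mono) auto
    also have "\<dots> \<le> (K * (r - \<rho>)) * r ^ k" using CK r by (intro mult_right_mono) auto
    finally have "norm (b k) \<le> (K * (r - \<rho>)) * r ^ k" .
    moreover have "\<rho> * norm (a k) \<le> \<rho> * (K * r ^ k)"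
      using Suc assms(2) by (intro mult_left_mono) auto
    ultimately show ?case using rec [of k] by (simp add: algebra_simps)
  qed
  then show ?thesis using r by (intro geo_decayI [of r]) auto
qed

lemma norm_vector_scale: "norm (c *s v) = cmod c * norm (v :: complex^'n)"
  by (simp add: norm_vec_def L2_set_def norm_mult power_mult_distrib sum_distrib_left [symmetric]
      real_sqrt_mult)

lemma subspace_geo_decay:
  fixes M :: "nat \<Rightarrow> complex^'n^'m"
  shows "vec.subspace {v. geo_decay (\<lambda>k. M k *v v)}"
proof -
  have "geo_decay (\<lambda>k. M k *v (c *s v))" if "geo_decay (\<lambda>k. M k *v v)" for c v
    using that by (rule geo_decay_bound [where c = "cmod c"])
      (simp add: vector_scalar_commute norm_vector_scale)
  then show ?thesis
    by (auto simp: vec.subspace_def geo_decay_0 matrix_vector_right_distrib geo_decay_add)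
qed

text \<open>With \<open>w = (A - mat e) *v v\<close>, which is one step further down the chain, the
  orbit of \<open>v\<close> satisfies a recurrence with factor \<open>e\<close> and input the orbit
  of \<open>w\<close>.\<close>

lemma geo_decay_forward:
  fixes A :: "complex^'n^'n"
  assumes "cmod e < 1" "matpow (A - mat e) m *v v = 0"
  shows "geo_decay (\<lambda>k. matpow A k *v v)"
  using assms(2)
proof (induction m arbitrary: v)
  case 0
  then show ?case by (simp add: geo_decay_0)
next
  case (Suc m)
  let ?w = "(A - mat e) *v v"
  have "geo_decay (\<lambda>k. matpow A k *v ?w)"
    by (rule Suc.IH) (use Suc.prems in \<open>simp only: matpow_Suc2 matrix_vector_mul_assoc\<close>)
  then show ?case
  proof (rule geo_decay_recurrence [where \<rho> = "cmod e"])
    fix k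
    have "matpow A (Suc k) *v v = matpow A k *v (A *v v)"
      by (simp only: matpow_Suc2 matrix_vector_mul_assoc)
    also have "A *v v = e *s v + ?w"
      by (simp add: matrix_vector_mult_diff_rdistrib)
    finally have "matpow A (Suc k) *v v = e *s (matpow A k *v v) + matpow A k *v ?w"
      by (simp only: matrix_vector_right_distrib vector_scalar_commute)
    then show "norm (matpow A (Suc k) *v v) \<le> cmod e * norm (matpow A k *v v) + norm (matpow A k *v ?w)"
      using norm_triangle_ineq [of "e *s (matpow A k *v v)" "matpow A k *v ?w"]
      by (simp only: norm_vector_scale)
  qed (use assms(1) in auto)
qed

text \<open>The forward argument for the inverse: \<open>Z\<close> stands for the complexified
  \<open>P_zero\<close>, and on its kernel \<open>D\<close> undoes \<open>A\<close>, so
  \<open>D *v v\<close> is \<open>inverse e *s v\<close> up to a term in the next chain vector. That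
  vector stays in the kernel because \<open>Z\<close> commutes with \<open>A\<close>.\<close>

lemma geo_decay_backward:
  fixes A D Z :: "complex^'n^'n"
  assumes e: "1 < cmod e"
    and D: "D ** A = mat 1 - Z" and Z: "Z ** A = A ** Z"
    and v: "matpow (A - mat e) m *v v = 0" "Z *v v = 0"
  shows "geo_decay (\<lambda>k. matpow D k *v v)"
  using v
proof (induction m arbitrary: v)
  case 0
  then show ?case by (simp add: geo_decay_0)
next
  case (Suc m)
  let ?w = "(A - mat e) *v v" and ?D = "\<lambda>k. matpow D k"
  have Zw: "Z *v ?w = 0"
    using Suc.prems(2) by (simp add: matrix_vector_mult_diff_rdistrib matrix_vector_mult_diff_distrib
        vector_scalar_commute matrix_vector_mul_assoc Z)
      (simp add: matrix_vector_mul_assoc [symmetric])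
  have "geo_decay (\<lambda>k. ?D k *v ?w)"
    by (rule Suc.IH [OF _ Zw]) (use Suc.prems in \<open>simp only: matpow_Suc2 matrix_vector_mul_assoc\<close>)
  moreover have "norm (D *v (matpow D k *v ?w)) \<le> onorm ((*v) D) * norm (matpow D k *v ?w)" for k
    by (rule onorm) (rule matrix_vector_mul_bounded_linear)
  ultimately have "geo_decay (\<lambda>k. D *v (?D k *v ?w))"
    by (rule geo_decay_bound)
  then have "geo_decay (\<lambda>k. inverse e *s (D *v (?D k *v ?w)))"
    by (rule geo_decay_bound [where c = "cmod (inverse e)"]) (simp add: norm_vector_scale)
  then show ?case
  proof (rule geo_decay_recurrence [where \<rho> = "cmod (inverse e)"])
    fix k
    have e0: "e \<noteq> 0" using e by auto
    have "D *v (A *v v) = v"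
      using Suc.prems(2) by (simp add: matrix_vector_mul_assoc D matrix_vector_mult_diff_rdistrib)
    moreover have "A *v v = e *s v + ?w"
      by (simp add: matrix_vector_mult_diff_rdistrib)
    ultimately have "v = e *s (D *v v) + D *v ?w"
      by (metis matrix_vector_right_distrib vector_scalar_commute)
    then have "inverse e *s v = D *v v + inverse e *s (D *v ?w)"
      by (metis e0 left_inverse vec.scale_one vec.scale_right_distrib vec.scale_scale)
    then have "D *v v = inverse e *s v - inverse e *s (D *v ?w)" by (simp add: algebra_simps)
    then have "?D k *v (D *v v) = inverse e *s (?D k *v v) - inverse e *s (?D k *v (D *v ?w))"
      by (simp add: matrix_vector_mult_diff_distrib vector_scalar_commute)
    moreover have "?D k *v (D *v u) = D *v (?D k *v u)" for u
      by (simp add: matrix_vector_mul_assoc matpow_commute)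
    ultimately have "?D (Suc k) *v v = inverse e *s (?D k *v v) - inverse e *s (D *v (?D k *v ?w))"
      by (simp add: matrix_vector_mul_assoc [symmetric])
    then show "norm (?D (Suc k) *v v) \<le> cmod (inverse e) * norm (?D k *v v)
        + norm (inverse e *s (D *v (?D k *v ?w)))"
      using norm_triangle_ineq4 [of "inverse e *s (?D k *v v)" "inverse e *s (D *v (?D k *v ?w))"]
      by (simp only: norm_vector_scale)
  qed (use e in \<open>auto simp: norm_inverse intro: inverse_less_1_iff [THEN iffD2]\<close>)
qed

lemma geo_decay_P_less1:
  fixes \<Phi> :: "real^'n^'n"
  shows "geo_decay (\<lambda>k. (matpow \<Phi> k ** P_less1 \<Phi>) *v v)"
proof -
  have "cvec v \<in> {w. geo_decay (\<lambda>k. (matpow (cmat \<Phi>) k ** cmat (P_less1 \<Phi>)) *v w)}"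
  proof (rule eigen_index_induct [of _ \<Phi>, OF subspace_geo_decay])
    fix e w assume ew: "e \<in> spectrum \<Phi>" "w \<in> gen_eigenspace \<Phi> e"
    have "cmat (P_less1 \<Phi>) *v w = (if cmod e < 1 then w else 0)"
      unfolding cmat_projections using ew by (subst spectral_proj_gen_eigenspace) auto
    moreover have "geo_decay (\<lambda>k. matpow (cmat \<Phi>) k *v w)" if "cmod e < 1"
      using that ew(2) unfolding gen_eigenspace_def by (intro geo_decay_forward) auto
    ultimately show "w \<in> {w. geo_decay (\<lambda>k. (matpow (cmat \<Phi>) k ** cmat (P_less1 \<Phi>)) *v w)}"
      by (simp add: matrix_vector_mul_assoc [symmetric] geo_decay_0)
  qed
  then have "geo_decay (\<lambda>k. (matpow (cmat \<Phi>) k ** cmat (P_less1 \<Phi>)) *v cvec v)" by simp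
  then show ?thesis
    by (rule geo_decay_bound [where c = 1])
      (simp flip: cmat_matpow cmat_mult cmat_mult_cvec)
qed

lemma geo_decay_P_left:
  fixes \<Phi> :: "real^'n^'n"
  shows "geo_decay (\<lambda>k. (matpow (drazin_inverse \<Phi>) k ** P_left \<Phi>) *v v)"
proof -
  let ?D = "cmat (drazin_inverse \<Phi>)"
  have "cvec v \<in> {w. geo_decay (\<lambda>k. (matpow ?D k ** cmat (P_left \<Phi>)) *v w)}"
  proof (rule eigen_index_induct [of _ \<Phi>, OF subspace_geo_decay])
    fix e w assume ew: "e \<in> spectrum \<Phi>" "w \<in> gen_eigenspace \<Phi> e"
    have "cmat (P_left \<Phi>) *v w = (if cmod e > 1 then w else 0)"
      unfolding cmat_projections using ew by (subst spectral_proj_gen_eigenspace) auto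
    moreover have "geo_decay (\<lambda>k. matpow ?D k *v w)" if "1 < cmod e"
    proof (rule geo_decay_backward [OF that])
      have "cmat (drazin_inverse \<Phi> ** \<Phi> + P_zero \<Phi>) = mat 1"
        by (simp add: drazin_inverse_props)
      then show "?D ** cmat \<Phi> = mat 1 - cmat (P_zero \<Phi>)"
        by (simp add: cmat_add cmat_mult algebra_simps)
      show "cmat (P_zero \<Phi>) ** cmat \<Phi> = cmat \<Phi> ** cmat (P_zero \<Phi>)"
        by (simp flip: cmat_mult add: projections_commute)
      show "matpow (cmat \<Phi> - mat e) CARD('n) *v w = 0" using ew(2) by (simp add: gen_eigenspace_def)
      show "cmat (P_zero \<Phi>) *v w = 0"
        unfolding cmat_projections using ew that by (subst spectral_proj_gen_eigenspace) auto
    qed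
    ultimately show "w \<in> {w. geo_decay (\<lambda>k. (matpow ?D k ** cmat (P_left \<Phi>)) *v w)}"
      by (simp add: matrix_vector_mul_assoc [symmetric] geo_decay_0)
  qed
  then have "geo_decay (\<lambda>k. (matpow ?D k ** cmat (P_left \<Phi>)) *v cvec v)" by simp
  then show ?thesis
    by (rule geo_decay_bound [where c = 1])
      (simp flip: cmat_matpow cmat_mult cmat_mult_cvec)
qed

text \<open>Decay is known only for fixed vectors, while \<epsilon> varies with \<open>k\<close>;
  expanding it in coordinates leaves finitely many fixed vectors. Injectivity of \<open>h\<close>
  turns the two-sided weighted sum into a bound for the series, and \<open>c\<close> absorbs the
  time shift.\<close>

lemma summable_geo_decay_subexponential:
  fixes M :: "nat \<Rightarrow> real^'n^'n" and h :: "nat \<Rightarrow> int"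
  assumes \<epsilon>: "subexponential \<epsilon>" and M: "\<And>v. geo_decay (\<lambda>k. M k *v v)"
    and h: "inj h" "\<And>k. nat \<bar>h k\<bar> \<le> k + c"
  shows "summable (\<lambda>k. M k *v \<epsilon> (h k))"
proof -
  have "summable (\<lambda>k. \<epsilon> (h k) $ i *s (M k *v axis i 1))" for i
  proof -
    obtain C r where r: "0 < r" "r < 1" and C: "\<And>k. norm (M k *v axis i 1) \<le> C * r ^ k"
      using M [of "axis i 1"] by (auto simp: geo_decay_def)
    have C0: "0 \<le> C" using order_trans [OF norm_ge_zero C [of 0]] by simp
    have "(\<lambda>t. r ^ nat \<bar>t\<bar> * norm (\<epsilon> t)) summable_on UNIV"
      using \<epsilon> r by (auto simp: subexponential_def)
    then have "(\<lambda>t. r ^ nat \<bar>t\<bar> * norm (\<epsilon> t)) summable_on range h"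
      by (rule summable_on_subset_banach) simp
    then have "(\<lambda>k. r ^ nat \<bar>h k\<bar> * norm (\<epsilon> (h k))) summable_on UNIV"
      by (simp add: summable_on_reindex [OF h(1)] o_def)
    then have "summable (\<lambda>k. r ^ nat \<bar>h k\<bar> * norm (\<epsilon> (h k)))"
      by (rule summable_on_imp_summable)
    then have "summable (\<lambda>k. C / r ^ c * (r ^ nat \<bar>h k\<bar> * norm (\<epsilon> (h k))))"
      by (rule summable_mult)
    then show ?thesis
    proof (rule summable_comparison_test' [where N = 0])
      fix k :: nat
      \<comment> \<open>The powers of \<open>r\<close> decrease, so the bound on \<open>h k\<close>
        trades the decay in \<open>k\<close> for the weight at time \<open>h k\<close>, up to the
        constant \<open>r ^ c\<close>.\<close>
      have "r ^ (k + c) \<le> r ^ nat \<bar>h k\<bar>"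
        using r h(2) by (intro power_decreasing) auto
      then have "r ^ k \<le> r ^ nat \<bar>h k\<bar> / r ^ c"
        using r by (simp add: power_add pos_le_divide_eq)
      then have "C * r ^ k \<le> C * (r ^ nat \<bar>h k\<bar> / r ^ c)"
        using C0 by (rule mult_left_mono)
      with C [of k] have "norm (M k *v axis i 1) \<le> C * (r ^ nat \<bar>h k\<bar> / r ^ c)" by linarith
      moreover have "\<bar>\<epsilon> (h k) $ i\<bar> \<le> norm (\<epsilon> (h k))" by (rule component_le_norm_cart)
      ultimately have "\<bar>\<epsilon> (h k) $ i\<bar> * norm (M k *v axis i 1)
          \<le> norm (\<epsilon> (h k)) * (C * (r ^ nat \<bar>h k\<bar> / r ^ c))"
        by (intro mult_mono) auto
      then show "norm (\<epsilon> (h k) $ i *s (M k *v axis i 1)) \<le> C / r ^ c * (r ^ nat \<bar>h k\<bar> * norm (\<epsilon> (h k)))"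
        by (simp add: scalar_mult_eq_scaleR mult_ac)
    qed
  qed
  then have "summable (\<lambda>k. \<Sum>i\<in>UNIV. \<epsilon> (h k) $ i *s (M k *v axis i 1))"
    by (rule summable_sum)
  then show ?thesis by (simp flip: matrix_vector_mult_axis_eq)
qed

section \<open>The unit circle\<close>

lemma cumulation_0 [simp]: "cumulation \<theta> y 0 = 0"
  by (simp add: cumulation_def)

text \<open>Explains the two branches of \<open>cumulation\<close>: they solve this one recurrence
  forwards and backwards from the value 0 at time 0.\<close>

lemma cumulation_rec: "cumulation \<theta> y t = cis (- \<theta>) *s cumulation \<theta> y (t - 1) + y t"
proof (cases "t \<ge> 1")
  case True
  \<comment> \<open>At \<open>u = 0\<close> the range is empty, so the middle clause of the
    definition is covered.\<close>
  have eq: "cumulation \<theta> y u = (\<Sum>s = 1..u. cis (- \<theta> * of_int (u - s)) *s y s)" if "u \<ge> 0" for u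
    using that by (simp add: cumulation_def)
  have "{1..t} = insert t {1..t - 1}" using True by auto
  then have "cumulation \<theta> y t = y t + (\<Sum>s = 1..t - 1. cis (- \<theta> * of_int (t - s)) *s y s)"
    using True by (simp add: eq)
  also have "(\<Sum>s = 1..t - 1. cis (- \<theta> * of_int (t - s)) *s y s) = cis (- \<theta>) *s cumulation \<theta> y (t - 1)"
    using True by (simp add: eq vec.scale_sum_right cis_mult algebra_simps)
  finally show ?thesis by (simp add: add.commute)
next
  case False
  have eq: "cumulation \<theta> y u = - (\<Sum>s = 0..- u - 1. cis (- \<theta> * of_int (u + s)) *s y (- s))" if "u \<le> 0" for u
    using that by (simp add: cumulation_def)
  \<comment> \<open>\<open>{0..- t}\<close> is the range belonging to time \<open>t - 1\<close>; its
    last term carries the phase 1 and is the input \<open>y t\<close>.\<close>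
  have "{0..- t} = insert (- t) {0..- t - 1}" using False by auto
  then have "cis (- \<theta>) *s cumulation \<theta> y (t - 1)
      = - (\<Sum>s \<in> insert (- t) {0..- t - 1}. cis (- \<theta> * of_int (t + s)) *s y (- s))"
    using False by (simp add: eq vec.scale_sum_right cis_mult algebra_simps)
  also have "\<dots> = cumulation \<theta> y t - y t"
    using False by (simp add: eq)
  finally show ?thesis by simp
qed

lemma residual_rec: "residual \<theta> v t = cis (- \<theta>) *s residual \<theta> v (t - 1)"
  by (simp add: residual_def cis_mult algebra_simps)

text \<open>The truncation error \<open>N ^ d ** P\<close> vanishes once \<open>d\<close> reaches the index of the eigenvalue.\<close>

lemma jordan_chain_sum_rec:
  fixes A P :: "complex^'n^'n" and W V :: "nat \<Rightarrow> int \<Rightarrow> complex^'n"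
  assumes V: "\<And>j. V (Suc j) t = W j (t - 1)"
    and W: "\<And>j. W j t = l *s W j (t - 1) + V j t"
  defines "N \<equiv> A - mat l"
  defines "S \<equiv> \<lambda>d t. \<Sum>j<d. (matpow N j ** P) *v W j t"
  shows "S d t = A *v S d (t - 1) + P *v V 0 t - (matpow N d ** P) *v V d t"
proof (induction d)
  case 0
  show ?case by (simp add: S_def)
next
  case (Suc d)
  \<comment> \<open>The scalar part of \<open>A\<close> advances the level through its own
    recurrence; the part with \<open>N\<close> is the input of the next level, since
    \<open>V (Suc d) t = W d (t - 1)\<close>. This is the telescoping.\<close>
  have A: "A *v u = l *s u + N *v u" for u
    by (simp add: N_def matrix_vector_mult_diff_rdistrib)
  have "S (Suc d) t = S d t + (matpow N d ** P) *v (l *s W d (t - 1) + V d t)"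
    by (simp add: S_def W [of d])
  moreover have "A *v S (Suc d) (t - 1) = A *v S d (t - 1) + A *v ((matpow N d ** P) *v W d (t - 1))"
    by (simp add: S_def matrix_vector_right_distrib)
  moreover have "A *v ((matpow N d ** P) *v W d (t - 1))
      = l *s ((matpow N d ** P) *v W d (t - 1)) + (matpow N (Suc d) ** P) *v V (Suc d) t"
    using A [of "(matpow N d ** P) *v W d (t - 1)"]
    by (simp add: V matrix_vector_mul_assoc matrix_mul_assoc)
  ultimately show ?case
    using Suc.IH by (simp add: matrix_vector_right_distrib vector_scalar_commute)
qed

definition unit_summand ::
    "real^'n^'n \<Rightarrow> (int \<Rightarrow> real^'n) \<Rightarrow> real^'n \<Rightarrow> real \<Rightarrow> int \<Rightarrow> complex^'n" where
  "unit_summand \<Phi> \<epsilon> v \<theta> t =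
     (\<Sum>k = 1..eigen_index \<Phi> (cis (- \<theta>)).
        (matpow (cmat \<Phi> - mat (cis (- \<theta>))) (k - 1) ** spectral_proj \<Phi> {cis (- \<theta>)}) *v
        ((cumulation \<theta> \<circ> backshift) ^^ (k - 1))
          (\<lambda>s. residual \<theta> (cvec v) s + cumulation \<theta> (\<lambda>u. cvec (\<epsilon> u)) s) t)"

lemma unit_part_eq: "unit_part \<Phi> \<epsilon> v t = (\<Sum>\<theta>\<in>Theta \<Phi>. unit_summand \<Phi> \<epsilon> v \<theta> t)"
  by (simp add: unit_part_def unit_summand_def)

lemma unit_summand_props:
  fixes \<Phi> :: "real^'n^'n"
  assumes "\<theta> \<in> Theta \<Phi>"
  shows "unit_summand \<Phi> \<epsilon> v \<theta> t = cmat \<Phi> *v unit_summand \<Phi> \<epsilon> v \<theta> (t - 1)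
      + spectral_proj \<Phi> {cis (- \<theta>)} *v cvec (\<epsilon> t)"
    and "unit_summand \<Phi> \<epsilon> v \<theta> 0 = spectral_proj \<Phi> {cis (- \<theta>)} *v cvec v"
    and "cmat (P_unit \<Phi>) *v unit_summand \<Phi> \<epsilon> v \<theta> t = unit_summand \<Phi> \<epsilon> v \<theta> t"
proof -
  define l where "l = cis (- \<theta>)"
  define d where "d = eigen_index \<Phi> l"
  define P where "P = spectral_proj \<Phi> {l}"
  define N where "N = cmat \<Phi> - mat l"
  define W where "W j = ((cumulation \<theta> \<circ> backshift) ^^ j)
    (\<lambda>s. residual \<theta> (cvec v) s + cumulation \<theta> (\<lambda>u. cvec (\<epsilon> u)) s)" for j
  \<comment> \<open>\<open>V j\<close> is the input of level \<open>j\<close>: the noise at the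
    bottom, the lagged previous level above it.\<close>
  define V where "V j t = (case j of 0 \<Rightarrow> cvec (\<epsilon> t) | Suc i \<Rightarrow> W i (t - 1))" for j t
  have l: "l \<in> spectrum \<Phi>" using assms by (simp add: Theta_def l_def)
  have NP: "matpow N d ** P = 0"
    unfolding N_def d_def P_def using l by (rule spectral_proj_nilpotent)
  have S: "unit_summand \<Phi> \<epsilon> v \<theta> t = (\<Sum>j<d. (matpow N j ** P) *v W j t)" for t
    unfolding unit_summand_def W_def [symmetric] l_def [symmetric] N_def [symmetric] P_def [symmetric]
      d_def [symmetric]
    by (rule sum.reindex_bij_witness [of _ Suc "\<lambda>k. k - 1"]) auto
  have W: "W j t = l *s W j (t - 1) + V j t" for j t
  proof (cases j)
    case 0
    then show ?thesis
      using residual_rec [of \<theta> "cvec v" t] cumulation_rec [of \<theta> "\<lambda>u. cvec (\<epsilon> u)" t]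
      by (simp add: W_def V_def l_def vec.scale_right_distrib)
  next
    case (Suc i)
    have "W (Suc i) = cumulation \<theta> (backshift (W i))" by (simp add: W_def)
    then show ?thesis
      using cumulation_rec [of \<theta> "backshift (W i)" t] Suc by (simp add: V_def l_def backshift_def)
  qed
  have rec: "unit_summand \<Phi> \<epsilon> v \<theta> t = cmat \<Phi> *v unit_summand \<Phi> \<epsilon> v \<theta> (t - 1)
      + P *v V 0 t - (matpow N d ** P) *v V d t"
    unfolding S N_def by (rule jordan_chain_sum_rec; (rule W)?; simp add: V_def)
  then show "unit_summand \<Phi> \<epsilon> v \<theta> t = cmat \<Phi> *v unit_summand \<Phi> \<epsilon> v \<theta> (t - 1)
      + spectral_proj \<Phi> {cis (- \<theta>)} *v cvec (\<epsilon> t)"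
    unfolding NP by (simp add: P_def l_def V_def)
  \<comment> \<open>Every cumulated sequence vanishes at time 0, so only the residual at the bottom
    level survives.\<close>
  have W0: "W j 0 = (if j = 0 then cvec v else 0)" for j
    by (cases j) (simp_all add: W_def residual_def)
  show "unit_summand \<Phi> \<epsilon> v \<theta> 0 = spectral_proj \<Phi> {cis (- \<theta>)} *v cvec v"
  proof (cases d)
    case 0
    \<comment> \<open>With \<open>d = 0\<close> the nilpotency \<open>NP\<close> reads
      \<open>P = 0\<close>, so the empty sum has the right value.\<close>
    then have "P = 0" using NP by simp
    then show ?thesis using 0 by (simp add: S P_def l_def)
  next
    case (Suc e)
    then show ?thesis by (simp add: S W0 sum.lessThan_Suc_shift P_def l_def del: sum.lessThan_Suc)
  qed
  let ?U = "cmat (P_unit \<Phi>)"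
  have U_comm: "?U ** cmat \<Phi> = cmat \<Phi> ** ?U"
    unfolding cmat_projections by (rule spectral_proj_commute) auto
  have "N ** ?U = ?U ** N"
    by (rule matrix_eq [THEN iffD2])
      (simp add: N_def matrix_vector_mul_assoc [symmetric] matrix_vector_mult_diff_rdistrib
        matrix_vector_mult_diff_distrib vector_scalar_commute,
       simp add: matrix_vector_mul_assoc U_comm)
  then have UN: "?U ** matpow N j = matpow N j ** ?U" for j by (simp add: matpow_commute)
  have "cmod l = 1" by (simp add: l_def)
  then have "{l \<in> spectrum \<Phi>. cmod l = 1} \<inter> {l} = {l}" using l by auto
  then have "?U ** P = P"
    unfolding cmat_projections P_def using l by (subst spectral_proj_mult) auto
  then have UNP: "?U ** (matpow N j ** P) = matpow N j ** P" for j
    by (metis UN matrix_mul_assoc)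
  show "?U *v unit_summand \<Phi> \<epsilon> v \<theta> t = unit_summand \<Phi> \<epsilon> v \<theta> t"
    by (simp add: S matrix_vector_mult_sum_right matrix_vector_mul_assoc UNP)
qed

lemma inj_on_cis_Theta: "inj_on (\<lambda>\<theta>. cis (- \<theta>)) (Theta \<Phi>)"
proof (rule inj_onI)
  fix a b assume ab: "a \<in> Theta \<Phi>" "b \<in> Theta \<Phi>" and "cis (- a) = cis (- b)"
  then have "cnj (cis (- a)) = cnj (cis (- b))" by simp
  then have "cis a = cis b" by (simp add: cis_cnj)
  moreover have "Arg (cis a) = a" "Arg (cis b) = b"
    by (rule cis_Arg_unique; use ab in \<open>simp add: Theta_def sgn_div_norm\<close>)+
  ultimately show "a = b" by metis
qed

lemma image_cis_Theta: "(\<lambda>\<theta>. cis (- \<theta>)) ` Theta \<Phi> = {l \<in> spectrum \<Phi>. cmod l = 1}"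
proof
  show "(\<lambda>\<theta>. cis (- \<theta>)) ` Theta \<Phi> \<subseteq> {l \<in> spectrum \<Phi>. cmod l = 1}"
    by (auto simp: Theta_def)
  show "{l \<in> spectrum \<Phi>. cmod l = 1} \<subseteq> (\<lambda>\<theta>. cis (- \<theta>)) ` Theta \<Phi>"
  proof clarify
    fix l assume l: "l \<in> spectrum \<Phi>" "cmod l = 1"
    then have "cnj l \<noteq> 0" by auto
    \<comment> \<open>The angle is \<open>Arg (cnj l)\<close>; taking \<open>- Arg l\<close> would
      leave the half-open interval at \<open>l = -1\<close>.\<close>
    then have "cis (Arg (cnj l)) = cnj l" using l by (simp add: cis_Arg sgn_div_norm)
    then have "cnj (cis (Arg (cnj l))) = l" by simp
    then have "cis (- Arg (cnj l)) = l" by (simp only: cis_cnj)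
    moreover have "- pi < Arg (cnj l)" "Arg (cnj l) \<le> pi" using Arg_bounded by auto
    ultimately show "l \<in> (\<lambda>\<theta>. cis (- \<theta>)) ` Theta \<Phi>"
      using l by (intro image_eqI [of _ _ "Arg (cnj l)"]) (simp_all add: Theta_def)
  qed
qed

lemma sum_spectral_proj_Theta:
  "(\<Sum>\<theta>\<in>Theta \<Phi>. spectral_proj \<Phi> {cis (- \<theta>)}) = cmat (P_unit \<Phi>)"
proof -
  have "finite ((\<lambda>\<theta>. cis (- \<theta>)) ` Theta \<Phi>)"
    unfolding image_cis_Theta by (rule finite_subset [OF _ finite_spectrum]) auto
  then have "finite (Theta \<Phi>)" using inj_on_cis_Theta by (rule finite_imageD)
  then have "(\<Sum>\<theta>\<in>Theta \<Phi>. spectral_proj \<Phi> {cis (- \<theta>)}) = spectral_proj \<Phi> ((\<lambda>\<theta>. cis (- \<theta>)) ` Theta \<Phi>)"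
    by (rule spectral_proj_sum [OF _ inj_on_cis_Theta]) (auto simp: image_cis_Theta)
  then show ?thesis by (simp add: image_cis_Theta cmat_projections)
qed

lemma unit_part_rec:
  "unit_part \<Phi> \<epsilon> v t = cmat \<Phi> *v unit_part \<Phi> \<epsilon> v (t - 1) + cmat (P_unit \<Phi>) *v cvec (\<epsilon> t)"
proof -
  have "unit_part \<Phi> \<epsilon> v t = (\<Sum>\<theta>\<in>Theta \<Phi>. cmat \<Phi> *v unit_summand \<Phi> \<epsilon> v \<theta> (t - 1)
      + spectral_proj \<Phi> {cis (- \<theta>)} *v cvec (\<epsilon> t))"
    unfolding unit_part_eq by (rule sum.cong [OF refl]) (rule unit_summand_props(1))
  then show ?thesis
    by (simp add: sum.distrib unit_part_eq matrix_vector_mult_sum_right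
        flip: matrix_vector_mult_sum_left sum_spectral_proj_Theta)
qed

lemma unit_part_0: "unit_part \<Phi> \<epsilon> v 0 = cmat (P_unit \<Phi>) *v cvec v"
  unfolding unit_part_eq sum_spectral_proj_Theta [symmetric] matrix_vector_mult_sum_left
  by (rule sum.cong [OF refl]) (rule unit_summand_props(2))

lemma P_unit_unit_part: "cmat (P_unit \<Phi>) *v unit_part \<Phi> \<epsilon> v t = unit_part \<Phi> \<epsilon> v t"
  unfolding unit_part_eq matrix_vector_mult_sum_right
  by (rule sum.cong [OF refl]) (rule unit_summand_props(3))

lemma drazin_inverse_P_unit: "drazin_inverse \<Phi> ** \<Phi> ** P_unit \<Phi> = P_unit \<Phi>"
  by (simp add: drazin_inverse_props matrix_diff_rdistrib projections_mult)

text \<open>Instead of pairing the summands of conjugate eigenvalues, realness is carried from time 0,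
  where it is evident, in both directions by the recurrence.\<close>

lemma unit_part_real: "\<exists>y. unit_part \<Phi> \<epsilon> v t = cvec y"
proof (induction t rule: int_induct [where k = 0])
  case base
  show ?case by (auto simp: unit_part_0 simp flip: cmat_mult_cvec)
next
  case (step1 i)
  then obtain y where "unit_part \<Phi> \<epsilon> v i = cvec y" by blast
  then have "unit_part \<Phi> \<epsilon> v (i + 1) = cvec (\<Phi> *v y + P_unit \<Phi> *v \<epsilon> (i + 1))"
    using unit_part_rec [of \<Phi> \<epsilon> v "i + 1"] by (simp add: cvec_add cmat_mult_cvec)
  then show ?case by blast
next
  case (step2 i)
  then obtain y where y: "unit_part \<Phi> \<epsilon> v i = cvec y" by blast
  let ?u = "unit_part \<Phi> \<epsilon> v (i - 1)" and ?D = "drazin_inverse \<Phi>"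
  \<comment> \<open>The value at \<open>i - 1\<close> lies in the range of \<open>P_unit\<close>,
    where the Drazin inverse undoes \<Phi>; so the recurrence can be solved backwards by a real
    matrix.\<close>
  have "?u = cmat (?D ** \<Phi> ** P_unit \<Phi>) *v ?u"
    by (simp add: drazin_inverse_P_unit P_unit_unit_part)
  also have "\<dots> = cmat ?D *v (cmat \<Phi> *v ?u)"
    by (simp add: cmat_mult matrix_vector_mul_assoc [symmetric] P_unit_unit_part)
  also have "cmat \<Phi> *v ?u = cvec (y - P_unit \<Phi> *v \<epsilon> i)"
    using unit_part_rec [of \<Phi> \<epsilon> v i] by (simp add: y cvec_diff cmat_mult_cvec)
  also have "cmat ?D *v \<dots> = cvec (?D *v (y - P_unit \<Phi> *v \<epsilon> i))"
    by (simp add: cmat_mult_cvec)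
  finally show ?case by blast
qed

section \<open>The recurrence\<close>

lemma span_columns_idempotent:
  fixes P :: "real^'n^'n"
  assumes "P ** P = P"
  shows "span (columns P) = {v. P *v v = v}"
proof
  have "P *v column i P = column i P" for i
    by (simp add: matrix_vector_mul_assoc assms flip: matrix_vector_mult_axis)
  then have "columns P \<subseteq> {v. P *v v = v}" by (auto simp: columns_def)
  moreover have "subspace {v. P *v v = v}"
    by (auto simp: real_vector.subspace_def matrix_vector_right_distrib matrix_vector_mult_scaleR)
  ultimately show "span (columns P) \<subseteq> {v. P *v v = v}" by (rule span_minimal)
  show "{v. P *v v = v} \<subseteq> span (columns P)"
  proof clarify
    fix v assume "P *v v = v"
    then show "v \<in> span (columns P)"
      using matrix_vector_mult_in_columnspace [of P v] by simp
  qed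
qed

lemma V_eq:
  "V_zero \<Phi> = {v. P_zero \<Phi> *v v = v}" "V_right \<Phi> = {v. P_right \<Phi> *v v = v}"
  "V_left \<Phi> = {v. P_left \<Phi> *v v = v}" "V_unit \<Phi> = {v. P_unit \<Phi> *v v = v}"
  by (simp_all add: V_zero_def V_right_def V_left_def V_unit_def span_columns_idempotent projections_mult)

lemma subspace_V: "subspace (V_zero \<Phi>)" "subspace (V_right \<Phi>)" "subspace (V_left \<Phi>)" "subspace (V_unit \<Phi>)"
  by (simp_all add: V_zero_def V_right_def V_left_def V_unit_def)

lemma projections_apply:
  "P_zero \<Phi> *v (P_zero \<Phi> *v v) = P_zero \<Phi> *v v" "P_right \<Phi> *v (P_right \<Phi> *v v) = P_right \<Phi> *v v"
  "P_left \<Phi> *v (P_left \<Phi> *v v) = P_left \<Phi> *v v" "P_unit \<Phi> *v (P_unit \<Phi> *v v) = P_unit \<Phi> *v v"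
  "P_zero \<Phi> *v (P_right \<Phi> *v v) = 0" "P_zero \<Phi> *v (P_left \<Phi> *v v) = 0" "P_zero \<Phi> *v (P_unit \<Phi> *v v) = 0"
  "P_right \<Phi> *v (P_zero \<Phi> *v v) = 0" "P_right \<Phi> *v (P_left \<Phi> *v v) = 0" "P_right \<Phi> *v (P_unit \<Phi> *v v) = 0"
  "P_left \<Phi> *v (P_zero \<Phi> *v v) = 0" "P_left \<Phi> *v (P_right \<Phi> *v v) = 0" "P_left \<Phi> *v (P_unit \<Phi> *v v) = 0"
  "P_unit \<Phi> *v (P_zero \<Phi> *v v) = 0" "P_unit \<Phi> *v (P_right \<Phi> *v v) = 0" "P_unit \<Phi> *v (P_left \<Phi> *v v) = 0"
  by (simp_all add: matrix_vector_mul_assoc projections_mult)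

lemma projections_sum_apply:
  "P_zero \<Phi> *v v + P_right \<Phi> *v v + P_left \<Phi> *v v + P_unit \<Phi> *v v = v"
  using projections_sum [of \<Phi>] by (simp flip: matrix_vector_mult_add_rdistrib)

text \<open>The sum is direct: the projections recover the summands. Injectivity of the solution map
  and the dimension count both reduce to this.\<close>

lemma V_components:
  assumes "z \<in> V_zero \<Phi>" "a \<in> V_right \<Phi>" "b \<in> V_left \<Phi>" "c \<in> V_unit \<Phi>"
  shows "P_zero \<Phi> *v (z + a + b + c) = z" "P_right \<Phi> *v (z + a + b + c) = a"
    "P_left \<Phi> *v (z + a + b + c) = b" "P_unit \<Phi> *v (z + a + b + c) = c"
proof -
  have eq: "z = P_zero \<Phi> *v z" "a = P_right \<Phi> *v a" "b = P_left \<Phi> *v b" "c = P_unit \<Phi> *v c"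
    using assms by (simp_all add: V_eq)
  have "P_zero \<Phi> *v (z + a + b + c) = P_zero \<Phi> *v z"
    by (subst eq(2), subst eq(3), subst eq(4)) (simp add: matrix_vector_right_distrib projections_apply)
  then show "P_zero \<Phi> *v (z + a + b + c) = z" using eq(1) by simp
  have "P_right \<Phi> *v (z + a + b + c) = P_right \<Phi> *v a"
    by (subst eq(1), subst eq(3), subst eq(4)) (simp add: matrix_vector_right_distrib projections_apply)
  then show "P_right \<Phi> *v (z + a + b + c) = a" using eq(2) by simp
  have "P_left \<Phi> *v (z + a + b + c) = P_left \<Phi> *v b"
    by (subst eq(1), subst eq(2), subst eq(4)) (simp add: matrix_vector_right_distrib projections_apply)
  then show "P_left \<Phi> *v (z + a + b + c) = b" using eq(3) by simp
  have "P_unit \<Phi> *v (z + a + b + c) = P_unit \<Phi> *v c"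
    by (subst eq(1), subst eq(2), subst eq(3)) (simp add: matrix_vector_right_distrib projections_apply)
  then show "P_unit \<Phi> *v (z + a + b + c) = c" using eq(4) by simp
qed

section \<open>Integer powers of \<Phi>\<close>

lemma matpow_int_minus: "matpow_int \<Phi> (- int k) = matpow (drazin_inverse \<Phi>) k"
  by (cases "k = 0") (simp_all add: matpow_int_def)

text \<open>\<open>\<Phi> ** D\<close> is the identity off the nilpotent part, and
  \<open>D^k v\<close> has no nilpotent component: for \<open>k = 0\<close> by assumption, for
  larger \<open>k\<close> because \<open>P_zero \<Phi> ** D = 0\<close>.\<close>

lemma drazin_inverse_cancel:
  assumes "P_zero \<Phi> *v v = 0"
  shows "\<Phi> *v (matpow (drazin_inverse \<Phi>) (Suc k) *v v) = matpow (drazin_inverse \<Phi>) k *v v"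
proof -
  let ?D = "drazin_inverse \<Phi>"
  have "P_zero \<Phi> *v (matpow ?D k *v v) = 0"
  proof (cases k)
    case (Suc j)
    have "P_zero \<Phi> ** matpow ?D (Suc j) = 0"
      by (simp add: matrix_mul_assoc drazin_inverse_props)
    then show ?thesis using Suc by (simp only: matrix_vector_mul_assoc matrix_vector_mult_0)
  qed (simp add: assms)
  moreover have "\<Phi> *v (matpow ?D (Suc k) *v v) = (\<Phi> ** ?D) *v (matpow ?D k *v v)"
    by (simp add: matrix_vector_mul_assoc matrix_mul_assoc)
  ultimately show ?thesis
    by (simp add: drazin_inverse_props matrix_vector_mult_diff_rdistrib)
qed

lemma matpow_int_rec:
  assumes "P_zero \<Phi> *v v = 0"
  shows "matpow_int \<Phi> t *v v = \<Phi> *v (matpow_int \<Phi> (t - 1) *v v)"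
proof (cases "t \<ge> 1")
  case True
  then have "nat t = Suc (nat (t - 1))" by simp
  then show ?thesis using True by (simp add: matpow_int_def matrix_vector_mul_assoc)
next
  case False
  define k where "k = nat (- t)"
  have t: "t = - int k" "t - 1 = - int (Suc k)" using False by (simp_all add: k_def)
  show ?thesis unfolding t(2) matpow_int_minus drazin_inverse_cancel [OF assms] by (simp add: t(1) matpow_int_minus)
qed

section \<open>The two series and their recurrences\<close>

lemma suminf_matrix_vector_mult:
  "summable f \<Longrightarrow> (\<Sum>k. A *v f k) = A *v (\<Sum>k. f k)" for A :: "real^'n^'m"
  by (rule bounded_linear.suminf [OF matrix_vector_mul_bounded_linear, symmetric])

lemma summable_forward_term:
  assumes "subexponential \<epsilon>"
  shows "summable (\<lambda>k. forward_term \<Phi> \<epsilon> t k)"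
  unfolding forward_term_def
  by (rule summable_geo_decay_subexponential [OF assms geo_decay_P_less1, where c = "nat \<bar>t\<bar>"])
    (auto simp: inj_def)

lemma summable_backward_term:
  assumes "subexponential \<epsilon>"
  shows "summable (\<lambda>k. backward_term \<Phi> \<epsilon> t k)"
  unfolding backward_term_def matpow_int_minus
  by (rule summable_geo_decay_subexponential [OF assms geo_decay_P_left, where c = "nat \<bar>t\<bar>"])
    (auto simp: inj_def)

lemma forward_sum_rec:
  assumes "subexponential \<epsilon>"
  shows "(\<Sum>k. forward_term \<Phi> \<epsilon> t k)
    = \<Phi> *v (\<Sum>k. forward_term \<Phi> \<epsilon> (t - 1) k) + P_less1 \<Phi> *v \<epsilon> t"
proof -
  have "forward_term \<Phi> \<epsilon> t (Suc k) = \<Phi> *v forward_term \<Phi> \<epsilon> (t - 1) k" for k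
    by (simp add: forward_term_def matrix_vector_mul_assoc matrix_mul_assoc algebra_simps)
  then have "(\<Sum>k. forward_term \<Phi> \<epsilon> t (Suc k)) = \<Phi> *v (\<Sum>k. forward_term \<Phi> \<epsilon> (t - 1) k)"
    using suminf_matrix_vector_mult [OF summable_forward_term [OF assms]] by simp
  moreover have "(\<Sum>k. forward_term \<Phi> \<epsilon> t (Suc k)) = (\<Sum>k. forward_term \<Phi> \<epsilon> t k) - P_less1 \<Phi> *v \<epsilon> t"
    using suminf_split_head [OF summable_forward_term [OF assms]] by (simp add: forward_term_def)
  ultimately show ?thesis by (simp add: algebra_simps)
qed

text \<open>Applying \<Phi> at time \<open>t - 1\<close> lowers each negative power by one, so the
  series from index 1 becomes the series at \<open>t\<close> from index 0. The new head is the
  input, with the right sign because \<open>sol_map\<close> subtracts this series.\<close>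

lemma backward_sum_rec:
  assumes "subexponential \<epsilon>"
  shows "\<Phi> *v (\<Sum>k. backward_term \<Phi> \<epsilon> (t - 1) (Suc k))
    = (\<Sum>k. backward_term \<Phi> \<epsilon> t (Suc k)) + P_left \<Phi> *v \<epsilon> t"
proof -
  have "\<Phi> *v backward_term \<Phi> \<epsilon> (t - 1) (Suc k) = backward_term \<Phi> \<epsilon> t k" for k
    using drazin_inverse_cancel [of \<Phi> "P_left \<Phi> *v \<epsilon> (t + int k)" k]
    by (simp only: backward_term_def matpow_int_minus projections_apply matrix_vector_mul_assoc [symmetric])
      (simp add: algebra_simps)
  then have "\<Phi> *v (\<Sum>k. backward_term \<Phi> \<epsilon> (t - 1) (Suc k)) = (\<Sum>k. backward_term \<Phi> \<epsilon> t k)"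
    using suminf_matrix_vector_mult [of "\<lambda>k. backward_term \<Phi> \<epsilon> (t - 1) (Suc k)" \<Phi>]
      summable_backward_term [OF assms, of \<Phi> "t - 1"] by (simp add: summable_Suc_iff)
  moreover have "(\<Sum>k. backward_term \<Phi> \<epsilon> t (Suc k)) = (\<Sum>k. backward_term \<Phi> \<epsilon> t k) - P_left \<Phi> *v \<epsilon> t"
    using suminf_split_head [OF summable_backward_term [OF assms]]
    by (simp add: backward_term_def matpow_int_def)
  ultimately show ?thesis by (simp add: algebra_simps)
qed

lemma real_unit_part_rec:
  "real_vec (unit_part \<Phi> \<epsilon> v t)
    = \<Phi> *v real_vec (unit_part \<Phi> \<epsilon> v (t - 1)) + P_unit \<Phi> *v \<epsilon> t"
proof -
  obtain y y' where y: "unit_part \<Phi> \<epsilon> v t = cvec y" and y': "unit_part \<Phi> \<epsilon> v (t - 1) = cvec y'"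
    using unit_part_real by metis
  have "cvec y = cvec (\<Phi> *v y' + P_unit \<Phi> *v \<epsilon> t)"
    using unit_part_rec [of \<Phi> \<epsilon> v t] by (simp add: y y' cvec_add cmat_mult_cvec)
  then show ?thesis unfolding y y' real_vec_cvec cvec_inject .
qed

lemma sol_map_solution:
  fixes \<Phi> :: "real^'n^'n"
  assumes \<epsilon>: "subexponential \<epsilon>" and p: "p \<in> V_right \<Phi> \<times> V_left \<Phi> \<times> V_unit \<Phi>"
  shows "sol_map \<Phi> \<epsilon> p \<in> solutions \<Phi> \<epsilon>"
proof -
  obtain a b c where abc: "p = (a, b, c)" "a = P_right \<Phi> *v a" "b = P_left \<Phi> *v b"
    using p by (auto simp: V_eq)
  have "P_zero \<Phi> *v a = 0" by (subst abc) (rule projections_apply)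
  moreover have "P_zero \<Phi> *v b = 0" by (subst abc) (rule projections_apply)
  ultimately have rec: "matpow_int \<Phi> t *v a = \<Phi> *v (matpow_int \<Phi> (t - 1) *v a)"
    "matpow_int \<Phi> t *v b = \<Phi> *v (matpow_int \<Phi> (t - 1) *v b)" for t
    by - (rule matpow_int_rec, assumption)+
  have sum: "P_less1 \<Phi> *v u + P_left \<Phi> *v u + P_unit \<Phi> *v u = u" for u
    using projections_sum_apply [of \<Phi> u] by (simp add: P_less1_eq matrix_vector_mult_add_rdistrib)
  \<comment> \<open>The subtracted part \<open>G\<close> enters with its recurrence reversed, as in
    \<open>backward_sum_rec\<close>; the three inputs add up to the full noise.\<close>
  have combine: "A + F + B - G + U = A' + F' + B' - G' + U' + e"
    if "A = A'" "F = F' + q" "B = B'" "G' = G + r" "U = U' + s" "q + r + s = e"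
    for A A' F F' B B' G G' U U' q r s e :: "real^'n"
    using that by (simp add: algebra_simps flip: that(6))
  have "sol_map \<Phi> \<epsilon> p t = \<Phi> *v sol_map \<Phi> \<epsilon> p (t - 1) + \<epsilon> t" for t
    unfolding sol_map_def abc(1) prod.case matrix_vector_right_distrib matrix_vector_mult_diff_distrib
    by (rule combine [OF rec(1) forward_sum_rec [OF \<epsilon>] rec(2) backward_sum_rec [OF \<epsilon>] real_unit_part_rec sum])
  then show ?thesis unfolding solutions_def by blast
qed

section \<open>Injectivity and range of the solution map\<close>

lemma sol_map_at_0:
  assumes "c \<in> V_unit \<Phi>"
  shows "sol_map \<Phi> \<epsilon> (a, b, c) 0
    = a + b + c + ((\<Sum>k. forward_term \<Phi> \<epsilon> 0 k) - (\<Sum>k. backward_term \<Phi> \<epsilon> 0 (Suc k)))"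
proof -
  have "unit_part \<Phi> \<epsilon> c 0 = cvec c"
    using assms by (simp add: unit_part_0 V_eq flip: cmat_mult_cvec)
  then show ?thesis by (simp add: sol_map_def matpow_int_def)
qed

text \<open>Used with \<open>m\<close> equal to the dimension: without noise it places a solution in
  the range of a high power of \<Phi>, and for nilpotent \<Phi> it gives the closed formula.\<close>

lemma solution_unroll:
  assumes "x \<in> solutions \<Phi> \<epsilon>"
  shows "x t = (\<Sum>k<m. matpow \<Phi> k *v \<epsilon> (t - int k)) + matpow \<Phi> m *v x (t - int m)"
proof (induction m)
  case (Suc m)
  have "x (t - int m) = \<Phi> *v x (t - int m - 1) + \<epsilon> (t - int m)"
    using assms unfolding solutions_def by blast
  moreover have "t - int m - 1 = t - int (Suc m)" by simp
  ultimately have "x (t - int m) = \<Phi> *v x (t - int (Suc m)) + \<epsilon> (t - int m)" by simp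
  then have "matpow \<Phi> m *v x (t - int m)
      = matpow \<Phi> (Suc m) *v x (t - int (Suc m)) + matpow \<Phi> m *v \<epsilon> (t - int m)"
    by (simp only: matrix_vector_right_distrib matpow_Suc2 matrix_vector_mul_assoc)
  then show ?case using Suc.IH by (simp add: algebra_simps)
qed simp

text \<open>A two-sided homogeneous solution has no nilpotent component, since it lies in the range of
  every power of \<open>\<Phi>\<close>; the rest of it is determined by its value at time 0.\<close>

lemma homogeneous_solution_zero:
  fixes \<Phi> :: "real^'n^'n" and z :: "int \<Rightarrow> real^'n"
  assumes z: "\<And>t. z t = \<Phi> *v z (t - 1)" and z0: "P_zero \<Phi> *v z 0 = z 0"
  shows "z t = 0"
proof -
  have sol: "z \<in> solutions \<Phi> (\<lambda>_. 0)"
    unfolding solutions_def by (rule CollectI, rule allI, subst add_0_right, rule z)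
  have P0: "P_zero \<Phi> *v z t = 0" for t
  proof -
    have "P_zero \<Phi> ** matpow \<Phi> CARD('n) = 0"
      using matpow_P_zero [of \<Phi>] matpow_commute [OF projections_commute(1) [of \<Phi>, symmetric], of "CARD('n)"] by simp
    then show ?thesis
      using solution_unroll [OF sol, of t "CARD('n)"] by (simp add: matrix_vector_mul_assoc)
  qed
  show ?thesis
  proof (induction t rule: int_induct [where k = 0])
    case base
    show ?case using P0 [of 0] z0 by simp
  next
    case (step1 i)
    then show ?case using z [of "i + 1"] by simp
  next
    case (step2 i)
    \<comment> \<open>\<open>drazin_inverse \<Phi> ** \<Phi>\<close> is the identity minus
      \<open>P_zero \<Phi>\<close>, and \<open>z (i - 1)\<close> has no nilpotent component, so it
      vanishes.\<close>
    have "(drazin_inverse \<Phi> ** \<Phi>) *v z (i - 1) = 0"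
      using step2 z [of i] by (simp flip: matrix_vector_mul_assoc)
    then show ?case by (simp add: drazin_inverse_props matrix_vector_mult_diff_rdistrib P0)
  qed
qed

lemma inj_on_sol_map: "inj_on (sol_map \<Phi> \<epsilon>) (V_right \<Phi> \<times> V_left \<Phi> \<times> V_unit \<Phi>)"
proof (rule inj_onI)
  fix p p' assume p: "p \<in> V_right \<Phi> \<times> V_left \<Phi> \<times> V_unit \<Phi>" "p' \<in> V_right \<Phi> \<times> V_left \<Phi> \<times> V_unit \<Phi>"
    and eq: "sol_map \<Phi> \<epsilon> p = sol_map \<Phi> \<epsilon> p'"
  obtain a b c where abc: "a \<in> V_right \<Phi>" "b \<in> V_left \<Phi>" "c \<in> V_unit \<Phi>" and p_eq: "p = (a, b, c)"
    using p(1) by blast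
  obtain a' b' c' where abc': "a' \<in> V_right \<Phi>" "b' \<in> V_left \<Phi>" "c' \<in> V_unit \<Phi>" and p'_eq: "p' = (a', b', c')"
    using p(2) by blast
  from eq have "sol_map \<Phi> \<epsilon> (a, b, c) 0 = sol_map \<Phi> \<epsilon> (a', b', c') 0"
    by (simp add: p_eq p'_eq)
  \<comment> \<open>The leading 0 is the summand from \<open>V_zero\<close>, which brings both sides
    into the form of \<open>V_components\<close>.\<close>
  then have eq0: "0 + a + b + c = 0 + a' + b' + c'"
    using abc abc' by (simp add: sol_map_at_0)
  have z: "0 \<in> V_zero \<Phi>" by (simp add: subspace_0 subspace_V)
  show "p = p'"
    using V_components [OF z abc, unfolded eq0] V_components [OF z abc'] by (simp add: p_eq p'_eq)
qed

lemma sol_map_image: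
  assumes "subexponential \<epsilon>"
  shows "sol_map \<Phi> \<epsilon> ` (V_right \<Phi> \<times> V_left \<Phi> \<times> V_unit \<Phi>) = solutions \<Phi> \<epsilon>"
proof
  show "sol_map \<Phi> \<epsilon> ` (V_right \<Phi> \<times> V_left \<Phi> \<times> V_unit \<Phi>) \<subseteq> solutions \<Phi> \<epsilon>"
    using sol_map_solution [OF assms] by blast
  show "solutions \<Phi> \<epsilon> \<subseteq> sol_map \<Phi> \<epsilon> ` (V_right \<Phi> \<times> V_left \<Phi> \<times> V_unit \<Phi>)"
  proof
    fix x assume x: "x \<in> solutions \<Phi> \<epsilon>"
    let ?s = "(\<Sum>k. forward_term \<Phi> \<epsilon> 0 k) - (\<Sum>k. backward_term \<Phi> \<epsilon> 0 (Suc k))"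
    \<comment> \<open>After removal of the constant part of \<open>sol_map\<close> at time 0, the
      components of \<open>w\<close> are the only possible parameters. The leftover
      \<open>P_zero \<Phi> *v w\<close> is the value at 0 of a homogeneous solution.\<close>
    define w where "w = x 0 - ?s"
    let ?p = "(P_right \<Phi> *v w, P_left \<Phi> *v w, P_unit \<Phi> *v w)"
    have p: "?p \<in> V_right \<Phi> \<times> V_left \<Phi> \<times> V_unit \<Phi>" by (simp add: V_eq projections_apply)
    define z where "z t = x t - sol_map \<Phi> \<epsilon> ?p t" for t
    have "z t = \<Phi> *v z (t - 1)" for t
    proof -
      have "x t = \<Phi> *v x (t - 1) + \<epsilon> t" "sol_map \<Phi> \<epsilon> ?p t = \<Phi> *v sol_map \<Phi> \<epsilon> ?p (t - 1) + \<epsilon> t"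
        using x sol_map_solution [OF assms p] unfolding solutions_def by blast+
      then show ?thesis by (simp add: z_def matrix_vector_mult_diff_distrib)
    qed
    moreover have "P_zero \<Phi> *v z 0 = z 0"
    proof -
      have "z 0 = w - (P_right \<Phi> *v w + P_left \<Phi> *v w + P_unit \<Phi> *v w)"
        using p by (simp add: z_def sol_map_at_0 w_def)
      also have "\<dots> = P_zero \<Phi> *v w"
        using projections_sum_apply [of \<Phi> w] by (simp add: diff_eq_eq add.assoc)
      finally show ?thesis by (simp add: projections_apply)
    qed
    ultimately have "z t = 0" for t by (rule homogeneous_solution_zero)
    then have "x = sol_map \<Phi> \<epsilon> ?p" by (auto simp: z_def)
    then show "x \<in> sol_map \<Phi> \<epsilon> ` (V_right \<Phi> \<times> V_left \<Phi> \<times> V_unit \<Phi>)" using p by blast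
  qed
qed

section \<open>The dimension of the parameter space\<close>

lemma dim_V:
  fixes \<Phi> :: "real^'n^'n"
  shows "dim (V_zero \<Phi>) + dim (V_right \<Phi> \<times> V_left \<Phi> \<times> V_unit \<Phi>) = CARD('n)"
proof -
  let ?W = "V_zero \<Phi> \<times> V_right \<Phi> \<times> V_left \<Phi> \<times> V_unit \<Phi>"
  \<comment> \<open>Addition of the four components is an isomorphism from the product of the column
    spaces onto the whole space.\<close>
  define f :: "(real^'n) \<times> (real^'n) \<times> (real^'n) \<times> (real^'n) \<Rightarrow> real^'n"
    where "f = (\<lambda>(z, a, b, c). z + a + b + c)"
  have sub: "subspace ?W" "subspace (V_right \<Phi> \<times> V_left \<Phi> \<times> V_unit \<Phi>)"
    by (intro subspace_Times subspace_V)+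
  have "linear f" by (rule linearI) (auto simp: f_def scaleR_add_right)
  moreover have "inj_on f (span ?W)"
    unfolding span_eq_iff [THEN iffD2, OF sub(1)]
  proof (rule inj_onI)
    fix p p' assume p: "p \<in> ?W" "p' \<in> ?W" and eq: "f p = f p'"
    obtain z a b c where zabc: "z \<in> V_zero \<Phi>" "a \<in> V_right \<Phi>" "b \<in> V_left \<Phi>" "c \<in> V_unit \<Phi>"
      and p_eq: "p = (z, a, b, c)" using p(1) by blast
    obtain z' a' b' c' where zabc': "z' \<in> V_zero \<Phi>" "a' \<in> V_right \<Phi>" "b' \<in> V_left \<Phi>" "c' \<in> V_unit \<Phi>"
      and p'_eq: "p' = (z', a', b', c')" using p(2) by blast
    have eq': "z + a + b + c = z' + a' + b' + c'" using eq by (simp add: f_def p_eq p'_eq)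
    show "p = p'"
      using V_components [OF zabc, unfolded eq'] V_components [OF zabc'] by (simp add: p_eq p'_eq)
  qed
  ultimately have "dim (f ` ?W) = dim ?W" by (rule dim_image_eq)
  moreover have "f ` ?W = UNIV"
  proof (rule UNIV_eq_I [symmetric])
    fix v
    have "v = f (P_zero \<Phi> *v v, P_right \<Phi> *v v, P_left \<Phi> *v v, P_unit \<Phi> *v v)"
      by (simp add: f_def projections_sum_apply)
    then show "v \<in> f ` ?W"
      by (rule image_eqI) (simp add: V_eq projections_apply)
  qed
  moreover have "dim ?W = dim (V_zero \<Phi>) + dim (V_right \<Phi> \<times> V_left \<Phi> \<times> V_unit \<Phi>)"
    by (rule dim_Times) (rule subspace_V sub)+
  ultimately show ?thesis by simp
qed

section \<open>The nilpotent case and its alternative\<close>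

lemma nilpotent_iff_P_zero: "nilpotent_matrix \<Phi> \<longleftrightarrow> P_zero \<Phi> = mat 1"
proof
  assume "nilpotent_matrix \<Phi>"
  then obtain k where k: "matpow \<Phi> k = 0" by (auto simp: nilpotent_matrix_def)
  have "l = 0" if "l \<in> spectrum \<Phi>" for l
  proof -
    from that obtain v where v: "v \<noteq> 0" "cmat \<Phi> *v v = l *s v"
      by (auto simp: spectrum_def)
    have "matpow (cmat \<Phi>) j *v v = l ^ j *s v" for j
      by (induction j) (simp_all add: v vector_scalar_commute matrix_vector_mul_assoc [symmetric] mult.commute)
    moreover have "matpow (cmat \<Phi>) k = 0" using k by (metis cmat_matpow cmat_0)
    ultimately have "l ^ k *s v = 0" by (metis matrix_vector_mult_0)
    then show ?thesis using v(1) by simp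
  qed
  \<comment> \<open>With 0 as the only eigenvalue, \<open>P_zero\<close> is the projection for the
    whole spectrum, hence the identity.\<close>
  then have "{l \<in> spectrum \<Phi>. l = 0} = spectrum \<Phi>" by auto
  then have "cmat (P_zero \<Phi>) = cmat (mat 1)"
    by (simp add: cmat_projections spectral_proj_spectrum)
  then show "P_zero \<Phi> = mat 1" by (simp only: cmat_inject)
next
  assume "P_zero \<Phi> = mat 1"
  then show "nilpotent_matrix \<Phi>"
    using matpow_P_zero [of \<Phi>] unfolding nilpotent_matrix_def by auto
qed

lemma infinite_V:
  assumes "P_zero \<Phi> \<noteq> mat 1"
  shows "infinite (V_right \<Phi> \<times> V_left \<Phi> \<times> V_unit \<Phi>)"
proof -
  obtain v where v: "P_zero \<Phi> *v v \<noteq> v" using assms by (auto simp: matrix_eq)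
  let ?p = "(P_right \<Phi> *v v, P_left \<Phi> *v v, P_unit \<Phi> *v v)"
  \<comment> \<open>If all three components vanished, \<open>P_zero \<Phi> *v v\<close> would be
    \<open>v\<close>. The multiples of \<open>?p\<close> are then infinitely many
    parameters.\<close>
  have "?p \<noteq> 0" using v projections_sum_apply [of \<Phi> v] by (auto simp: zero_prod_def)
  then have "inj (\<lambda>r. r *\<^sub>R ?p)" by (intro injI) (simp only: scaleR_cancel_right, simp)
  then have "infinite (range (\<lambda>r::real. r *\<^sub>R ?p))"
    using finite_imageD infinite_UNIV_char_0 by blast
  moreover have "subspace (V_right \<Phi> \<times> V_left \<Phi> \<times> V_unit \<Phi>)"
    by (intro subspace_Times subspace_V)
  then have "range (\<lambda>r. r *\<^sub>R ?p) \<subseteq> V_right \<Phi> \<times> V_left \<Phi> \<times> V_unit \<Phi>"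
    by (intro image_subsetI subspace_scale) (simp_all add: V_eq projections_apply)
  ultimately show ?thesis using finite_subset by blast
qed

lemma nilpotent_V:
  assumes "P_zero \<Phi> = mat 1"
  shows "V_right \<Phi> \<times> V_left \<Phi> \<times> V_unit \<Phi> = {(0, 0, 0)}"
proof -
  have "P_right \<Phi> = 0" "P_left \<Phi> = 0" "P_unit \<Phi> = 0"
    \<comment> \<open>With \<open>P_zero \<Phi> = mat 1\<close> these three products are the other
      projections themselves.\<close>
    using projections_mult(5-7) [of \<Phi>] by (simp_all add: assms)
  then show ?thesis by (auto simp: V_eq)
qed

lemma nilpotent_solutions:
  fixes \<Phi> :: "real^'n^'n"
  assumes \<epsilon>: "subexponential \<epsilon>" and nil: "P_zero \<Phi> = mat 1"
  shows "x \<in> solutions \<Phi> \<epsilon> \<longleftrightarrow>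
    (\<forall>t. x t = (\<Sum>k = 0..CARD('n) - 1. matpow \<Phi> k *v \<epsilon> (t - int k)))"
proof -
  let ?s = "\<lambda>t. \<Sum>k = 0..CARD('n) - 1. matpow \<Phi> k *v \<epsilon> (t - int k)"
  have "matpow \<Phi> CARD('n) = 0" using matpow_P_zero [of \<Phi>] nil by simp
  moreover have "CARD('n) = Suc (CARD('n) - 1)" by simp
  \<comment> \<open>The dimension is positive, so no truncated subtraction interferes.\<close>
  then have "{..<CARD('n)} = {0..CARD('n) - 1}" by (metis lessThan_Suc_atMost atMost_atLeast0)
  ultimately have formula: "y = ?s" if "y \<in> solutions \<Phi> \<epsilon>" for y
    using solution_unroll [OF that, of _ "CARD('n)"] by auto
  \<comment> \<open>That the formula is a solution is inferred rather than computed: some solution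
    exists, and unrolling shows that it is given by the formula.\<close>
  obtain y where y: "y \<in> solutions \<Phi> \<epsilon>"
    using sol_map_image [OF \<epsilon>, of \<Phi>] nilpotent_V [OF nil] by blast
  have s: "?s \<in> solutions \<Phi> \<epsilon>" using y unfolding formula [OF y] .
  show ?thesis
  proof
    assume "x \<in> solutions \<Phi> \<epsilon>"
    then show "\<forall>t. x t = ?s t" by (intro allI) (subst formula [of x], assumption, rule refl)
  next
    assume "\<forall>t. x t = ?s t"
    then have "x = ?s" by (intro ext) (rule spec)
    then show "x \<in> solutions \<Phi> \<epsilon>" using s by (simp only:)
  qed
qed

theorem mainTheorem2:
  fixes \<Phi> :: "real^'n^'n" and \<epsilon> :: "int \<Rightarrow> real^'n"
  assumes "subexponential \<epsilon>"
  shows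
    "(\<forall>t. summable (\<lambda>k. forward_term \<Phi> \<epsilon> t k) \<and> summable (\<lambda>k. backward_term \<Phi> \<epsilon> t (Suc k)))
   \<and> (\<forall>v \<in> V_unit \<Phi>. \<forall>t. \<exists>y. unit_part \<Phi> \<epsilon> v t = cvec y)
   \<and> inj_on (sol_map \<Phi> \<epsilon>) (V_right \<Phi> \<times> V_left \<Phi> \<times> V_unit \<Phi>)
   \<and> sol_map \<Phi> \<epsilon> ` (V_right \<Phi> \<times> V_left \<Phi> \<times> V_unit \<Phi>) = solutions \<Phi> \<epsilon>
   \<and> int (dim (V_right \<Phi> \<times> V_left \<Phi> \<times> V_unit \<Phi>)) = int CARD('n) - int (dim (V_zero \<Phi>))
   \<and> ((\<exists>!x. x \<in> solutions \<Phi> \<epsilon>) \<longleftrightarrow> nilpotent_matrix \<Phi>)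
   \<and> (nilpotent_matrix \<Phi> \<longrightarrow>
        (\<forall>x. x \<in> solutions \<Phi> \<epsilon> \<longleftrightarrow>
          (\<forall>t. x t = (\<Sum>k = 0..CARD('n) - 1. matpow \<Phi> k *v \<epsilon> (t - int k)))))
   \<and> (\<not> nilpotent_matrix \<Phi> \<longrightarrow> infinite (solutions \<Phi> \<epsilon>))"
proof -
  note image = sol_map_image [OF assms, of \<Phi>]
  have infinite: "infinite (solutions \<Phi> \<epsilon>)" if "\<not> nilpotent_matrix \<Phi>"
    using infinite_V [of \<Phi>] that finite_imageD [OF _ inj_on_sol_map, of \<Phi> \<epsilon>]
    unfolding nilpotent_iff_P_zero image by blast
  have unique: "(\<exists>!x. x \<in> solutions \<Phi> \<epsilon>) \<longleftrightarrow> nilpotent_matrix \<Phi>"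
  proof
    assume "\<exists>!x. x \<in> solutions \<Phi> \<epsilon>"
    then obtain x where "solutions \<Phi> \<epsilon> = {x}" by blast
    then show "nilpotent_matrix \<Phi>" using infinite by force
  next
    assume "nilpotent_matrix \<Phi>"
    then have "solutions \<Phi> \<epsilon> = {sol_map \<Phi> \<epsilon> (0, 0, 0)}"
      unfolding image [symmetric] by (simp add: nilpotent_iff_P_zero nilpotent_V)
    then show "\<exists>!x. x \<in> solutions \<Phi> \<epsilon>" by auto
  qed
  have "summable (\<lambda>k. backward_term \<Phi> \<epsilon> t (Suc k))" for t
    using summable_backward_term [OF assms] by (simp add: summable_Suc_iff)
  moreover have "int (dim (V_right \<Phi> \<times> V_left \<Phi> \<times> V_unit \<Phi>)) = int CARD('n) - int (dim (V_zero \<Phi>))"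
    using dim_V [of \<Phi>] by linarith
  moreover have "x \<in> solutions \<Phi> \<epsilon> \<longleftrightarrow>
      (\<forall>t. x t = (\<Sum>k = 0..CARD('n) - 1. matpow \<Phi> k *v \<epsilon> (t - int k)))" if "nilpotent_matrix \<Phi>" for x
    using that by (intro nilpotent_solutions [OF assms]) (simp only: nilpotent_iff_P_zero)
  ultimately show ?thesis
    by (intro conjI allI ballI impI summable_forward_term [OF assms] unit_part_real inj_on_sol_map image unique infinite)
qed

end
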